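(* Let $G$ be an outerplanar graph with maximum degree $\Delta$. Then $\chi'_{st}(G) \le \left\lfloor \frac{3}{2}\Delta \right\rfloor + 12$.
   Context: A star edge coloring of a graph $G$ is a proper edge coloring of $G$ such that there is no bichromatic path and no bichromatic cycle of length four (i.e., every path and every cycle with four edges uses at least three distinct colors). The star chromatic index $\chi'_{st}(G)$ is the minimum number of colors for which $G$ admits a star edge coloring. *)

theory Defs
  imports "HOL-Analysis.Analysis"
begin

section \<open>Finite simple graphs\<close>

text \<open>An edge is the two-element set of its end vertices.\<close>

definition simple_graph :: "'a set \<Rightarrow> 'a set set \<Rightarrow> bool" where
  "simple_graph V E \<longleftrightarrow> finite V \<and> (\<forall>e\<in>E. e \<subseteq> V \<and> card e = 2)"

definition degree :: "'a set set \<Rightarrow> 'a \<Rightarrow> nat" where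
  "degree E v = card {e \<in> E. v \<in> e}"

text \<open>Inserting 0 only matters for the graph without vertices, whose maximum degree is set to 0.\<close>

definition max_degree :: "'a set \<Rightarrow> 'a set set \<Rightarrow> nat" where
  "max_degree V E = Max (insert 0 (degree E ` V))"


section \<open>Outerplanar graphs\<close>

text \<open>
  The plane is the type of complex numbers. A plane drawing sends the vertices to distinct points
  and every edge to an arc between its two end vertices; an arc meets the set of vertex points
  only in its ends, and two arcs meet only in the points of common end vertices.
\<close>

definition plane_drawing ::
  "'a set \<Rightarrow> 'a set set \<Rightarrow> ('a \<Rightarrow> complex) \<Rightarrow> ('a set \<Rightarrow> real \<Rightarrow> complex) \<Rightarrow> bool" where
  "plane_drawing V E pos \<gamma> \<longleftrightarrow>
     inj_on pos V \<and>
     (\<forall>e\<in>E. arc (\<gamma> e) \<and> {pathstart (\<gamma> e), pathfinish (\<gamma> e)} = pos ` e \<and>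
            path_image (\<gamma> e) \<inter> pos ` V = pos ` e) \<and>
     (\<forall>e\<in>E. \<forall>e'\<in>E. e \<noteq> e' \<longrightarrow> path_image (\<gamma> e) \<inter> path_image (\<gamma> e') = pos ` (e \<inter> e'))"

definition drawing_set ::
  "'a set \<Rightarrow> 'a set set \<Rightarrow> ('a \<Rightarrow> complex) \<Rightarrow> ('a set \<Rightarrow> real \<Rightarrow> complex) \<Rightarrow> complex set" where
  "drawing_set V E pos \<gamma> = pos ` V \<union> (\<Union>e\<in>E. path_image (\<gamma> e))"

text \<open>
  For a finite graph the drawing is compact, so its complement has exactly one unbounded
  component, the outer face, and this is \<^term>\<open>outside (drawing_set V E pos \<gamma>)\<close>.
\<close>

definition outerplanar :: "'a set \<Rightarrow> 'a set set \<Rightarrow> bool" where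
  "outerplanar V E \<longleftrightarrow>
     (\<exists>pos \<gamma>. plane_drawing V E pos \<gamma> \<and>
            (\<forall>v\<in>V. pos v \<in> frontier (outside (drawing_set V E pos \<gamma>))))"


section \<open>Star edge colorings\<close>

definition proper_edge_coloring :: "'a set set \<Rightarrow> ('a set \<Rightarrow> 'c) \<Rightarrow> bool" where
  "proper_edge_coloring E f \<longleftrightarrow>
     (\<forall>e\<in>E. \<forall>e'\<in>E. e \<noteq> e' \<and> e \<inter> e' \<noteq> {} \<longrightarrow> f e \<noteq> f e')"

text \<open>Paths and cycles are subgraphs, not necessarily induced.\<close>

definition star_edge_coloring :: "'a set set \<Rightarrow> ('a set \<Rightarrow> 'c) \<Rightarrow> bool" where
  "star_edge_coloring E f \<longleftrightarrow>
     proper_edge_coloring E f \<and>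
     (\<forall>u v w x y. distinct [u, v, w, x, y] \<and> {{u, v}, {v, w}, {w, x}, {x, y}} \<subseteq> E \<longrightarrow>
        card (f ` {{u, v}, {v, w}, {w, x}, {x, y}}) \<ge> 3) \<and>
     (\<forall>u v w x. distinct [u, v, w, x] \<and> {{u, v}, {v, w}, {w, x}, {x, u}} \<subseteq> E \<longrightarrow>
        card (f ` {{u, v}, {v, w}, {w, x}, {x, u}}) \<ge> 3)"

definition star_chromatic_index :: "'a set set \<Rightarrow> nat" where
  "star_chromatic_index E =
     (LEAST k. \<exists>f :: 'a set \<Rightarrow> nat. star_edge_coloring E f \<and> f ` E \<subseteq> {..<k})"

text \<open>The minimum is attained, since an injective coloring is a star edge coloring.\<close>

lemma star_chromatic_index_attained:
  fixes E :: "'a set set"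
  assumes "finite E"
  shows "\<exists>f :: 'a set \<Rightarrow> nat. star_edge_coloring E f \<and> f ` E \<subseteq> {..<star_chromatic_index E}"
proof -
  obtain f :: "'a set \<Rightarrow> nat" and k where f: "f ` E = {i. i < k}" "inj_on f E"
    using finite_imp_inj_to_nat_seg[OF assms] by blast
  have card_image_ge: "card (f ` S) \<ge> 3" if "S \<subseteq> E" "card S \<ge> 3" for S
    using that f(2) by (simp add: card_image inj_on_subset)
  have "star_edge_coloring E f"
    unfolding star_edge_coloring_def
  proof (intro conjI allI impI)
    show "proper_edge_coloring E f"
      using f(2) by (auto simp: proper_edge_coloring_def inj_on_def)
  next
    fix u v w x y
    assume "distinct [u, v, w, x, y] \<and> {{u, v}, {v, w}, {w, x}, {x, y}} \<subseteq> E"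
    then show "card (f ` {{u, v}, {v, w}, {w, x}, {x, y}}) \<ge> 3"
      by (intro card_image_ge) (auto simp: card_insert_if doubleton_eq_iff)
  next
    fix u v w x
    assume "distinct [u, v, w, x] \<and> {{u, v}, {v, w}, {w, x}, {x, u}} \<subseteq> E"
    then show "card (f ` {{u, v}, {v, w}, {w, x}, {x, u}}) \<ge> 3"
      by (intro card_image_ge) (auto simp: card_insert_if doubleton_eq_iff)
  qed
  moreover have "f ` E \<subseteq> {..<k}"
    using f(1) by auto
  ultimately have "\<exists>k. \<exists>f :: 'a set \<Rightarrow> nat. star_edge_coloring E f \<and> f ` E \<subseteq> {..<k}"
    by blast
  then show ?thesis
    unfolding star_chromatic_index_def by (rule LeastI_ex)
qed

end

theory Submission
  imports Defs
begin

text \<open>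
  If three internally disjoint arcs join two points of the plane, the interior of one of them lies
  inside the closed curve formed by the other two, so not all three can pass through points on the
  boundary of the outer face. Hence an outerplanar graph has no \<open>K\<^bsub>2,3\<^esub>\<close> with both vertices of
  the small side blown up to connected sets, and this is all that is used about the drawing.

  Layer each component by the distance from a root and contract what lies below a layer. Excluding
  \<open>K\<^bsub>2,3\<^esub>\<close> shows: a vertex has at most two parents in the previous layer and at most two
  neighbors in its own layer, at most two children of a vertex have a second parent, the edges within layers contain no
  cycle of length at least four, and the two-parent vertices, joined when they share a parent, form no
  cycle. Choose one parent for each vertex. The resulting spanning forest is colored with
  \<open>\<lfloor>3\<Delta>/2\<rfloor>\<close> colors. The edges within a layer get three colors of their own such that edges at
  distance at most one differ, alternating between two palettes from layer to layer, and the edges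
  to second parents get two colors, rotating through three palettes: \<open>2 * 3 + 3 * 2 = 12\<close> extra colors.

  The forest is colored from the root down. The colors at a vertex are arranged cyclically, starting
  with the color of the edge to its parent; a child may use below itself all colors absent at the
  vertex and the colors of the next half turn. No two edges at a vertex then find each other's color
  at their far ends.
\<close>

section \<open>Theta curves and the exclusion of K23\<close>

text \<open>If no arc enters the inside of the curve formed by the other two, a point
  \<open>p\<close> inside the first curve lies outside the two others, which have the connected arc
  \<open>c3\<close> in common. Janiszewski's theorem then joins \<open>p\<close> to a far point in
  the complement of all three arcs, although \<open>p\<close> is inside a closed curve.\<close>

lemma theta_curve_inside_separation:
  fixes c1 c2 c3 :: "real \<Rightarrow> complex"
  assumes arcs: "arc c1" "arc c2" "arc c3"
    and starts: "pathstart c1 = a" "pathstart c2 = a" "pathstart c3 = a"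
    and ends: "pathfinish c1 = b" "pathfinish c2 = b" "pathfinish c3 = b"
    and meets: "path_image c1 \<inter> path_image c2 = {a, b}" "path_image c1 \<inter> path_image c3 = {a, b}"
      "path_image c2 \<inter> path_image c3 = {a, b}"
    and o1: "inside (path_image c2 \<union> path_image c3) \<inter> path_image c1 = {}"
    and o2: "inside (path_image c1 \<union> path_image c3) \<inter> path_image c2 = {}"
    and o3: "inside (path_image c1 \<union> path_image c2) \<inter> path_image c3 = {}"
  shows False
proof -
  have J: "inside (path_image c \<union> path_image d) \<noteq> {} \<and> connected (inside (path_image c \<union> path_image d))
     \<and> connected (outside (path_image c \<union> path_image d))
     \<and> frontier (inside (path_image c \<union> path_image d)) = path_image c \<union> path_image d"
    if "arc c" "arc d" "pathstart c = a" "pathstart d = a" "pathfinish c = b" "pathfinish d = b"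
      "path_image c \<inter> path_image d = {a, b}" for c d
  proof -
    have "simple_path (c +++ reversepath d)"
      using that by (intro simple_path_join_loop) (auto simp: arc_reversepath)
    with that show ?thesis
      using Jordan_inside_outside[of "c +++ reversepath d"]
      by (simp add: path_image_join)
  qed
  \<comment> \<open>Otherwise one inside region contains the other. Then \<open>d\<close>, on the
    boundary of the smaller one, lies in the closure of the larger one; as it misses the larger
    inside, it lies on \<open>c\<close> and \<open>e\<close>, so it would consist of
    \<open>a\<close> and \<open>b\<close> alone.\<close>
  have not_in: "p \<notin> inside (path_image c \<union> path_image e)"
    if "arc c" "arc d" "arc e" "pathstart c = a" "pathstart d = a" "pathstart e = a"
      "pathfinish c = b" "pathfinish d = b" "pathfinish e = b"
      "path_image c \<inter> path_image d = {a, b}" "path_image c \<inter> path_image e = {a, b}"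
      "path_image d \<inter> path_image e = {a, b}"
      "inside (path_image c \<union> path_image e) \<inter> path_image d = {}"
      "inside (path_image c \<union> path_image d) \<inter> path_image e = {}"
      "p \<in> inside (path_image c \<union> path_image d)" for c d e p
  proof
    let ?I = "inside (path_image c \<union> path_image d)"
    let ?J = "inside (path_image c \<union> path_image e)"
    assume p: "p \<in> ?J"
    have "?I \<subseteq> ?J"
    proof
      fix q assume q: "q \<in> ?I"
      have "?I \<subseteq> - (path_image c \<union> path_image e)"
        using that(14) inside_no_overlap[of "path_image c \<union> path_image d"] by blast
      moreover have "connected ?I"
        using J[of c d] that by auto
      ultimately have "connected_component (- (path_image c \<union> path_image e)) p q"
        unfolding connected_component_def using that(15) q by blast
      then show "q \<in> ?J"
        using p inside_same_component by blast
    qed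
    then have "closure ?I \<subseteq> closure ?J"
      by (rule closure_mono)
    moreover have "path_image d \<subseteq> closure ?I"
      using J[of c d] that by (auto simp: frontier_def)
    moreover have "closure ?J \<subseteq> ?J \<union> (path_image c \<union> path_image e)"
      using J[of c e] that closure_Un_frontier[of ?J] by auto
    ultimately have "path_image d \<subseteq> {a, b}"
      using that by blast
    moreover have "path_image d - {a, b} \<noteq> {}"
      using nonempty_simple_path_endless[of d] that by (auto simp: arc_imp_simple_path)
    ultimately show False by blast
  qed
  obtain p where p: "p \<in> inside (path_image c1 \<union> path_image c2)"
    using J[of c1 c2] assms by blast
  let ?S = "path_image c1 \<union> path_image c3" and ?T = "path_image c2 \<union> path_image c3"
  have "p \<notin> inside ?S"
    by (rule not_in[of c1 c2 c3]) (use assms p in auto)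
  moreover have "p \<notin> inside ?T"
    by (rule not_in[of c2 c1 c3]) (use assms p in \<open>auto simp: Un_commute\<close>)
  moreover have "p \<notin> ?S \<union> ?T"
    using p o3 inside_no_overlap by blast
  ultimately have p_out: "p \<in> outside ?S" "p \<in> outside ?T"
    using inside_Un_outside by blast+
  have "compact (?S \<union> ?T)"
    using arcs by (intro compact_Un compact_path_image) (auto simp: arc_imp_path)
  \<comment> \<open>The far point: outside all three arcs together, hence outside each of the three
    closed curves.\<close>
  then obtain q where q: "q \<in> outside (?S \<union> ?T)"
    using outside_bounded_nonempty[of "?S \<union> ?T"] compact_imp_bounded by blast
  have q_out: "q \<in> outside ?S" "q \<in> outside ?T" "q \<in> outside (path_image c1 \<union> path_image c2)"
    using q outside_mono[of _ "?S \<union> ?T"] by blast+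
  have cc: "connected_component (- U) p q"
    if "connected (outside U)" "p \<in> outside U" "q \<in> outside U" for U
    unfolding connected_component_def using that outside_no_overlap by blast
  have "connected_component (- (?S \<union> ?T)) p q"
  proof (rule Janiszewski)
    show "compact ?S" "closed ?T"
      using arcs by (auto simp: compact_arc_image closed_arc_image compact_Un closed_Un)
    have "?S \<inter> ?T = path_image c3"
      using meets arcs starts ends by blast
    then show "connected (?S \<inter> ?T)"
      by (simp add: arcs connected_arc_image)
    show "connected_component (- ?S) p q"
      using J[of c1 c3] assms p_out q_out by (intro cc) auto
    show "connected_component (- ?T) p q"
      using J[of c2 c3] assms p_out q_out by (intro cc) auto
  qed
  then have "connected_component (- (path_image c1 \<union> path_image c2)) p q"
    by (rule connected_component_of_subset) auto
  then have "q \<in> inside (path_image c1 \<union> path_image c2)"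
    using p inside_same_component by blast
  with q_out(3) show False
    using inside_Int_outside by blast
qed

text \<open>An arc that enters the inside of the curve formed by the other two keeps its whole
  interior there, because it meets that curve only in \<open>a\<close> and \<open>b\<close>. Its
  marked point then has a neighborhood disjoint from \<open>outside D\<close> and is not on the
  outer frontier. So no arc enters such an inside, contrary to the separation lemma.\<close>

lemma theta_curve_not_all_on_outer_face:
  fixes c1 c2 c3 :: "real \<Rightarrow> complex"
  assumes arcs: "arc c1" "arc c2" "arc c3"
    and starts: "pathstart c1 = a" "pathstart c2 = a" "pathstart c3 = a"
    and ends: "pathfinish c1 = b" "pathfinish c2 = b" "pathfinish c3 = b"
    and meets: "path_image c1 \<inter> path_image c2 = {a, b}" "path_image c1 \<inter> path_image c3 = {a, b}"
      "path_image c2 \<inter> path_image c3 = {a, b}"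
    and sub: "path_image c1 \<subseteq> D" "path_image c2 \<subseteq> D" "path_image c3 \<subseteq> D"
    and pts: "p1 \<in> path_image c1 - {a, b}" "p2 \<in> path_image c2 - {a, b}" "p3 \<in> path_image c3 - {a, b}"
    and frontier: "{p1, p2, p3} \<subseteq> frontier (outside D)"
  shows False
proof -
  have sep: "inside (path_image d \<union> path_image e) \<inter> path_image c = {}"
    if "arc c" "arc d" "arc e" "pathstart c = a" "pathfinish c = b"
      "path_image c \<inter> path_image d = {a, b}" "path_image c \<inter> path_image e = {a, b}"
      "path_image d \<subseteq> D" "path_image e \<subseteq> D"
      "p \<in> path_image c - {a, b}" "p \<in> frontier (outside D)" for c d e p
  proof (rule ccontr)
    let ?C = "path_image d \<union> path_image e"
    assume "inside ?C \<inter> path_image c \<noteq> {}"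
    then obtain r where r: "r \<in> inside ?C" "r \<in> path_image c" by blast
    have rd: "r \<in> path_image c - {a, b}"
      using r that inside_no_overlap[of ?C] by blast
    have "connected (path_image c - {a, b})"
      using connected_simple_path_endless[of c] that by (simp add: arc_imp_simple_path)
    moreover have "path_image c - {a, b} \<subseteq> - ?C"
      using that by blast
    ultimately have "connected_component (- ?C) r p"
      unfolding connected_component_def using rd that by blast
    then have "p \<in> inside ?C"
      using r inside_same_component by blast
    moreover have "open (inside ?C)"
      using that by (intro open_inside closed_Un closed_arc_image)
    moreover have "p \<in> closure (outside D)"
      using that by (simp add: frontier_def)
    ultimately have "inside ?C \<inter> outside D \<noteq> {}"
      using open_Int_closure_eq_empty[of "inside ?C" "outside D"] by blast
    moreover have "outside D \<subseteq> outside ?C"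
      using that by (intro outside_mono) auto
    ultimately show False
      using inside_Int_outside[of ?C] by blast
  qed
  show False
  proof (rule theta_curve_inside_separation[OF arcs starts ends meets])
    show "inside (path_image c2 \<union> path_image c3) \<inter> path_image c1 = {}"
      using assms by (intro sep[of _ _ _ p1]) auto
    show "inside (path_image c1 \<union> path_image c3) \<inter> path_image c2 = {}"
      using assms by (intro sep[of _ _ _ p2]) (simp_all add: Int_commute)
    show "inside (path_image c1 \<union> path_image c2) \<inter> path_image c3 = {}"
      using assms by (intro sep[of _ _ _ p3]) (simp_all add: Int_commute)
  qed
qed

section \<open>Tripods in path-connected sets\<close>

lemma path_connected_arc_minus_start:
  assumes "arc g"
  shows "path_connected (path_image g - {pathstart g})"
proof -
  have "inj_on g {0..1}"
    using assms by (simp add: arc_def)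
  then have "g ` ({0..1} - {0}) = g ` {0..1} - g ` {0}"
    by (rule inj_on_image_set_diff) auto
  moreover have "{0..1} - {0} = {0<..1::real}"
    by auto
  ultimately have "path_image g - {pathstart g} = g ` {0<..1}"
    by (simp add: path_image_def pathstart_def)
  moreover have "continuous_on {0<..1} g"
    using assms by (intro continuous_on_subset[of "{0..1}" g "{0<..1}"]) (auto simp: arc_def path_def)
  ultimately show ?thesis
    by (simp add: path_connected_continuous_image convex_imp_path_connected)
qed

text \<open>Connect \<open>p1\<close> to \<open>p2\<close> by an arc, walk from \<open>p3\<close>
  until that arc is first met, and take the meeting point \<open>z\<close> as the center. The
  delicate point is that \<open>z\<close> must differ from \<open>p1\<close> and \<open>p2\<close>;
  this is arranged by confining the walk to a set that contains neither.\<close>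

lemma tripod:
  fixes D :: "'a :: {complete_space, real_normed_vector} set"
  assumes D: "path_connected D"
    and arcs: "arc g1" "arc g2" "arc g3"
    and fin: "pathfinish g1 \<in> D" "pathfinish g2 \<in> D" "pathfinish g3 \<in> D"
    and st: "pathstart g1 = p1" "pathstart g2 = p2" "pathstart g3 = p3"
    and out: "p1 \<notin> D" "p2 \<notin> D" "p3 \<notin> D"
    and leaf: "p1 \<notin> path_image g2 \<union> path_image g3" "p2 \<notin> path_image g1 \<union> path_image g3"
      "p3 \<notin> path_image g1 \<union> path_image g2"
  obtains z t1 t2 t3 where "z \<notin> {p1, p2, p3}" "arc t1" "arc t2" "arc t3"
    "pathstart t1 = z" "pathstart t2 = z" "pathstart t3 = z"
    "pathfinish t1 = p1" "pathfinish t2 = p2" "pathfinish t3 = p3"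
    "path_image t1 \<inter> path_image t2 = {z}" "path_image t1 \<inter> path_image t3 = {z}"
    "path_image t2 \<inter> path_image t3 = {z}"
    "path_image t1 \<union> path_image t2 \<union> path_image t3
       \<subseteq> D \<union> path_image g1 \<union> path_image g2 \<union> path_image g3"
proof -
  have pc: "path_connected (path_image g)" if "arc g" for g :: "real \<Rightarrow> 'a"
    using that by (simp add: arc_imp_path path_connected_path_image)
  have ends_in: "pathstart g \<in> path_image g" "pathfinish g \<in> path_image g" for g :: "real \<Rightarrow> 'a"
    by auto
  have "path_connected (D \<union> path_image g1 \<union> path_image g2)"
    using D fin arcs ends_in by (intro path_connected_Un pc) blast+
  moreover have "p1 \<noteq> p2"
    using leaf st ends_in by blast
  moreover have "p1 \<in> D \<union> path_image g1 \<union> path_image g2" "p2 \<in> D \<union> path_image g1 \<union> path_image g2"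
    using st ends_in by blast+
  ultimately obtain \<alpha> where \<alpha>: "arc \<alpha>" "path_image \<alpha> \<subseteq> D \<union> path_image g1 \<union> path_image g2"
      "pathstart \<alpha> = p1" "pathfinish \<alpha> = p2"
    unfolding path_connected_arcwise by blast
  have \<alpha>_ends: "p1 \<in> path_image \<alpha>" "p2 \<in> path_image \<alpha>"
    using ends_in[of \<alpha>] \<alpha> by simp_all
  have g_ends: "p1 \<in> path_image g1" "p2 \<in> path_image g2" "p3 \<in> path_image g3"
    using ends_in(1)[of g1] ends_in(1)[of g2] ends_in(1)[of g3] st by simp_all
  \<comment> \<open>The target of the walk must be reachable without touching \<open>p1\<close> or
    \<open>p2\<close>. It exists because the connected arc cannot be split into the disjoint closed
    pieces \<open>{p1}\<close> and its part on \<open>g2\<close>.\<close>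
  obtain s where s: "s \<in> path_image \<alpha>" "s \<noteq> p1" "s \<notin> path_image g2"
  proof -
    have "\<not> path_image \<alpha> \<subseteq> {p1} \<union> path_image g2"
    proof
      assume sub: "path_image \<alpha> \<subseteq> {p1} \<union> path_image g2"
      have "connected (path_image \<alpha>)" "closed {p1}" "closed (path_image g2)"
        using \<alpha> arcs by (auto simp: connected_arc_image closed_arc_image)
      moreover have "{p1} \<inter> path_image g2 \<inter> path_image \<alpha> = {}"
        using leaf by auto
      moreover have "{p1} \<inter> path_image \<alpha> \<noteq> {}" "path_image g2 \<inter> path_image \<alpha> \<noteq> {}"
        using \<alpha>_ends g_ends by blast+
      ultimately show False
        using sub connected_closed[of "path_image \<alpha>"] by blast
    qed
    then show ?thesis using that by blast
  qed
  \<comment> \<open>\<open>?U\<close> contains neither \<open>p1\<close>, which is removed as the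
    start of \<open>g1\<close>, nor \<open>p2\<close>, which lies on neither \<open>g1\<close> nor
    \<open>g3\<close>.\<close>
  let ?U = "D \<union> path_image g3 \<union> (path_image g1 - {pathstart g1})"
  have "path_connected ?U"
  proof (intro path_connected_Un D pc arcs)
    show "path_connected (path_image g1 - {pathstart g1})"
      by (rule path_connected_arc_minus_start[OF arcs(1)])
    show "D \<inter> path_image g3 \<noteq> {}"
      using fin(3) ends_in(2)[of g3] by blast
    have "pathfinish g1 \<noteq> p1"
      using fin(1) out(1) by auto
    then show "(D \<union> path_image g3) \<inter> (path_image g1 - {pathstart g1}) \<noteq> {}"
      using fin(1) st(1) ends_in(2)[of g1] by blast
  qed
  moreover have "s \<in> ?U" "p3 \<in> ?U"
    using s \<alpha>(2) st(1) g_ends by blast+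
  ultimately obtain \<beta> where \<beta>: "path \<beta>" "path_image \<beta> \<subseteq> ?U" "pathstart \<beta> = p3" "pathfinish \<beta> = s"
    unfolding path_connected_def by metis
  have p3: "p3 \<notin> path_image \<alpha>"
    using \<alpha> out leaf by blast
  have cl: "closed (path_image \<alpha>)"
    by (simp add: \<alpha> closed_arc_image)
  have ps: "pathstart \<beta> \<in> closure (- path_image \<alpha>)"
    using \<beta> p3 closure_subset by fastforce
  have pf: "pathfinish \<beta> \<notin> - path_image \<alpha>"
    using \<beta> s by auto
  \<comment> \<open>\<open>h\<close> is the initial piece of the walk up to its first contact with
    the arc.\<close>
  obtain h where h: "path h" "pathstart h = p3" "path_image h \<subseteq> path_image \<beta>"
      "path_image h - {pathfinish h} \<subseteq> interior (- path_image \<alpha>)"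
      "pathfinish h \<in> frontier (- path_image \<alpha>)"
    using exists_path_subpath_to_frontier[OF \<beta>(1) ps pf] \<beta>(3) by metis
  define z where "z = pathfinish h"
  have z\<alpha>: "z \<in> path_image \<alpha>"
    using h(5) cl frontier_subset_closed[OF cl] by (auto simp: z_def)
  have hz: "path_image h \<inter> path_image \<alpha> = {z}"
    using h(4) z\<alpha> interior_subset[of "- path_image \<alpha>"] ends_in(2)[of h] by (fastforce simp: z_def)
  have "z \<in> ?U"
    using h(3) \<beta>(2) ends_in(2)[of h] by (auto simp: z_def)
  then have zne: "z \<notin> {p1, p2, p3}"
    using p3 z\<alpha> out leaf st by auto
  then obtain t3' where t3': "arc t3'" "path_image t3' \<subseteq> path_image h" "pathstart t3' = p3" "pathfinish t3' = z"
    using path_contains_arc[OF h(1) h(2), of z] by (auto simp: z_def)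
  obtain u where u: "u \<in> {0..1}" "\<alpha> u = z"
    using z\<alpha> by (auto simp: path_image_def)
  have \<alpha>01: "\<alpha> 0 = p1" "\<alpha> 1 = p2"
    using \<alpha> by (auto simp: pathstart_def pathfinish_def)
  have u01: "u \<noteq> 0" "u \<noteq> 1"
    using u zne \<alpha>01 by auto
  define t1 where "t1 = subpath u 0 \<alpha>"
  define t2 where "t2 = subpath u 1 \<alpha>"
  have im: "path_image t1 = \<alpha> ` {0..u}" "path_image t2 = \<alpha> ` {u..1}"
    using u by (auto simp: t1_def t2_def path_image_subpath path_image_subpath_commute[of u 0])
  have "\<alpha> ` {0..u} \<inter> \<alpha> ` {u..1} = \<alpha> ` ({0..u} \<inter> {u..1})"
    using \<alpha>(1) u by (intro inj_on_image_Int[symmetric, where C = "{0..1}"]) (auto simp: arc_def)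
  also have "{0..u} \<inter> {u..1} = {u}"
    using u by auto
  finally have t12: "path_image t1 \<inter> path_image t2 = {z}"
    using u im by simp
  have sub12: "path_image t1 \<subseteq> path_image \<alpha>" "path_image t2 \<subseteq> path_image \<alpha>"
    unfolding im unfolding path_image_def using u by (auto intro!: image_mono)
  have z1: "z \<in> path_image t1" "z \<in> path_image t2"
    using t12 by auto
  have z3: "z \<in> path_image t3'"
    using t3' ends_in by blast
  show thesis
  proof
    show "z \<notin> {p1, p2, p3}" by fact
    show "arc t1" "arc t2"
      unfolding t1_def t2_def using \<alpha>(1) u u01 by (auto intro!: arc_subpath_arc)
    show "arc (reversepath t3')"
      using t3' by (simp add: arc_reversepath)
    show "pathstart t1 = z" "pathstart t2 = z" "pathstart (reversepath t3') = z"
      "pathfinish t1 = p1" "pathfinish t2 = p2" "pathfinish (reversepath t3') = p3"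
      using u \<alpha>01 t3' by (simp_all add: t1_def t2_def)
    show "path_image t1 \<inter> path_image t2 = {z}" by fact
    show "path_image t1 \<inter> path_image (reversepath t3') = {z}"
      "path_image t2 \<inter> path_image (reversepath t3') = {z}"
      using t3' hz sub12 z1 z3 by auto
    show "path_image t1 \<union> path_image t2 \<union> path_image (reversepath t3')
       \<subseteq> D \<union> path_image g1 \<union> path_image g2 \<union> path_image g3"
      using sub12 \<alpha>(2) t3' h(3) \<beta>(2) by auto
  qed
qed

section \<open>K23 models and plane drawings\<close>

definition connected_in :: "'a set set \<Rightarrow> 'a set \<Rightarrow> bool" where
  "connected_in E A \<longleftrightarrow> (\<forall>a\<in>A. \<forall>b\<in>A. (a, b) \<in> {(x, y). x \<in> A \<and> y \<in> A \<and> {x, y} \<in> E}\<^sup>*)"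

text \<open>A violation is a model of a \<open>K23\<close> minor in which the three vertices of the
  larger side are single vertices. The empty set is \<open>connected_in\<close>, but the required
  neighbors make \<open>A\<close> and \<open>B\<close> nonempty.\<close>

definition K23_free :: "'a set \<Rightarrow> 'a set set \<Rightarrow> bool" where
  "K23_free V E \<longleftrightarrow>
     (\<forall>A B x1 x2 x3. A \<subseteq> V \<and> B \<subseteq> V \<and> connected_in E A \<and> connected_in E B \<and> A \<inter> B = {} \<and>
        distinct [x1, x2, x3] \<and> {x1, x2, x3} \<inter> (A \<union> B) = {} \<longrightarrow>
        \<not> (\<forall>x\<in>{x1, x2, x3}. (\<exists>a\<in>A. {x, a} \<in> E) \<and> (\<exists>b\<in>B. {x, b} \<in> E)))"

text \<open>A vertex point lies on an edge only as one of its ends, and a point that is no vertex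
  lies on at most one edge. The ends of \<open>F\<close> are added to \<open>W\<close> because an
  edge of \<open>F\<close> may leave \<open>W\<close>.\<close>

lemma drawing_set_Int:
  assumes pd: "plane_drawing V E pos \<gamma>" and sg: "simple_graph V E"
    and "W \<subseteq> V" "W' \<subseteq> V" "F \<subseteq> E" "F' \<subseteq> E" "F \<inter> F' = {}"
  shows "drawing_set W F pos \<gamma> \<inter> drawing_set W' F' pos \<gamma> \<subseteq> pos ` ((W \<union> \<Union>F) \<inter> (W' \<union> \<Union>F'))"
proof
  fix p assume p: "p \<in> drawing_set W F pos \<gamma> \<inter> drawing_set W' F' pos \<gamma>"
  have inj: "inj_on pos V"
    using pd by (simp add: plane_drawing_def)
  have edge: "e \<subseteq> V" if "e \<in> E" for e
    using that sg by (simp add: simple_graph_def)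
  have on_edge: "p \<in> pos ` e" if "e \<in> E" "p \<in> path_image (\<gamma> e)" "p \<in> pos ` V" for e
  proof -
    have "path_image (\<gamma> e) \<inter> pos ` V = pos ` e"
      using pd that(1) by (simp add: plane_drawing_def)
    then show ?thesis using that(2,3) by (metis IntI)
  qed
  have two_edges: "p \<in> pos ` (e \<inter> e')"
    if "e \<in> E" "p \<in> path_image (\<gamma> e)" "e' \<in> E" "p \<in> path_image (\<gamma> e')" "e \<noteq> e'" for e e'
  proof -
    have "path_image (\<gamma> e) \<inter> path_image (\<gamma> e') = pos ` (e \<inter> e')"
      using pd that(1,3,5) by (simp add: plane_drawing_def)
    then show ?thesis using that(2,4) by (metis IntI)
  qed
  have vertex: "p \<in> pos ` X" if U: "p \<in> pos ` V" "p \<in> drawing_set U G pos \<gamma>" "U \<subseteq> V" "G \<subseteq> E" "X = U \<union> \<Union>G"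
    for U G X
  proof (cases "p \<in> pos ` U")
    case False
    then obtain e where "e \<in> G" "p \<in> path_image (\<gamma> e)"
      using U by (auto simp: drawing_set_def)
    then show ?thesis
      using on_edge[of e] U by blast
  qed (use U in blast)
  show "p \<in> pos ` ((W \<union> \<Union>F) \<inter> (W' \<union> \<Union>F'))"
  proof (cases "p \<in> pos ` V")
    case True
    then have "p \<in> pos ` (W \<union> \<Union>F)" "p \<in> pos ` (W' \<union> \<Union>F')"
      using vertex[of W F] vertex[of W' F'] p assms by blast+
    then show ?thesis
      using inj_on_image_Int[OF inj, of "W \<union> \<Union>F" "W' \<union> \<Union>F'"] edge assms by blast
  next
    case False
    then obtain e e' where "e \<in> F" "p \<in> path_image (\<gamma> e)" "e' \<in> F'" "p \<in> path_image (\<gamma> e')"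
      using p assms unfolding drawing_set_def by blast
    then show ?thesis
      using two_edges[of e e'] assms by blast
  qed
qed

lemma path_connected_drawing:
  assumes pd: "plane_drawing V E pos \<gamma>" and conn: "connected_in E A"
    and sg: "simple_graph V E"
  shows "path_connected (drawing_set A {e \<in> E. e \<subseteq> A} pos \<gamma>)"
proof -
  let ?D = "drawing_set A {e \<in> E. e \<subseteq> A} pos \<gamma>"
  have edge: "path_component ?D p q" if "e \<in> E" "e \<subseteq> A" "p \<in> path_image (\<gamma> e)" "q \<in> path_image (\<gamma> e)" for e p q
  proof -
    have "path_connected (path_image (\<gamma> e))"
      using pd that by (simp add: plane_drawing_def arc_imp_path path_connected_path_image)
    moreover have "path_image (\<gamma> e) \<subseteq> ?D"
      using that by (auto simp: drawing_set_def)
    ultimately show ?thesis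
      using that path_component_of_subset unfolding path_connected_component by blast
  qed
  have vertex_on: "pos v \<in> path_image (\<gamma> e)" if "e \<in> E" "v \<in> e" for e v
    using pd that unfolding plane_drawing_def by blast
  have "path_component ?D (pos a) (pos b)" if "a \<in> A" "b \<in> A" for a b
  proof -
    have "(a, b) \<in> {(x, y). x \<in> A \<and> y \<in> A \<and> {x, y} \<in> E}\<^sup>*"
      using conn that by (simp add: connected_in_def)
    then show ?thesis
    proof (induction rule: rtrancl_induct)
      case base
      show ?case
        using that by (simp add: path_component_refl_eq drawing_set_def)
    next
      case (step y z)
      then have "path_component ?D (pos y) (pos z)"
        by (intro edge[of "{y, z}"] vertex_on) auto
      with step.IH show ?case
        by (rule path_component_trans)
    qed
  qed
  moreover have "\<exists>a\<in>A. path_component ?D p (pos a)" if p: "p \<in> ?D" for p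
  proof (cases "p \<in> pos ` A")
    case True
    then show ?thesis
      using path_component_refl[OF p] by auto
  next
    case False
    then obtain e where e: "e \<in> E" "e \<subseteq> A" "p \<in> path_image (\<gamma> e)"
      using p by (auto simp: drawing_set_def)
    moreover have "e \<noteq> {}"
      using sg e by (auto simp: simple_graph_def)
    ultimately show ?thesis
      using edge vertex_on by blast
  qed
  ultimately show ?thesis
    unfolding path_connected_component
    by (meson path_component_sym path_component_trans)
qed

text \<open>The path-connected set is the drawing of the subgraph on \<open>A\<close>, the legs are
  the three edges from \<open>A\<close> to \<open>x1\<close>, \<open>x2\<close>, \<open>x3\<close>.
  These three points are not in the set, since an edge within \<open>A\<close> meets vertex points
  only in its ends.\<close>

lemma tripod_in_drawing:
  assumes pd: "plane_drawing V E pos \<gamma>" and sg: "simple_graph V E"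
    and A: "A \<subseteq> V" "connected_in E A"
    and x: "distinct [x1, x2, x3]" "{x1, x2, x3} \<inter> A = {}"
    and a: "a1 \<in> A" "a2 \<in> A" "a3 \<in> A" "{x1, a1} \<in> E" "{x2, a2} \<in> E" "{x3, a3} \<in> E"
  obtains z t1 t2 t3 where "z \<notin> {pos x1, pos x2, pos x3}" "arc t1" "arc t2" "arc t3"
    "pathstart t1 = z" "pathstart t2 = z" "pathstart t3 = z"
    "pathfinish t1 = pos x1" "pathfinish t2 = pos x2" "pathfinish t3 = pos x3"
    "path_image t1 \<inter> path_image t2 = {z}" "path_image t1 \<inter> path_image t3 = {z}"
    "path_image t2 \<inter> path_image t3 = {z}"
    "path_image t1 \<union> path_image t2 \<union> path_image t3
       \<subseteq> drawing_set A ({e \<in> E. e \<subseteq> A} \<union> {{x1, a1}, {x2, a2}, {x3, a3}}) pos \<gamma>"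
proof -
  have inj: "inj_on pos V"
    using pd by (simp add: plane_drawing_def)
  have xV: "x1 \<in> V" "x2 \<in> V" "x3 \<in> V"
    using sg a by (auto simp: simple_graph_def)
  have pos_eq: "pos u = pos v \<longleftrightarrow> u = v" if "u \<in> V" "v \<in> V" for u v
    using inj that by (auto simp: inj_on_def)
  have im: "path_image (\<gamma> e) \<inter> pos ` V = pos ` e" if "e \<in> E" for e
    using pd that unfolding plane_drawing_def by blast
  let ?D = "drawing_set A {e \<in> E. e \<subseteq> A} pos \<gamma>"
  \<comment> \<open>A drawing does not prescribe the direction of an edge, so the arc may have to be
    reversed.\<close>
  have ray: "\<exists>g. arc g \<and> path_image g = path_image (\<gamma> {x, a}) \<and> pathstart g = pos x \<and> pathfinish g = pos a"
    if "{x, a} \<in> E" "a \<in> A" "x \<notin> A" for x a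
  proof -
    let ?g = "\<gamma> {x, a}"
    have "arc ?g" "{pathstart ?g, pathfinish ?g} = {pos x, pos a}"
      using pd that by (auto simp: plane_drawing_def)
    then show ?thesis
      by (metis arc_reversepath doubleton_eq_iff path_image_reversepath pathfinish_reversepath pathstart_reversepath)
  qed
  obtain g1 where g1: "arc g1" "path_image g1 = path_image (\<gamma> {x1, a1})" "pathstart g1 = pos x1" "pathfinish g1 = pos a1"
    using ray[of x1 a1] a x by auto
  obtain g2 where g2: "arc g2" "path_image g2 = path_image (\<gamma> {x2, a2})" "pathstart g2 = pos x2" "pathfinish g2 = pos a2"
    using ray[of x2 a2] a x by auto
  obtain g3 where g3: "arc g3" "path_image g3 = path_image (\<gamma> {x3, a3})" "pathstart g3 = pos x3" "pathfinish g3 = pos a3"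
    using ray[of x3 a3] a x by auto
  have notD: "pos v \<notin> ?D" if "v \<in> V" "v \<notin> A" for v
  proof
    assume "pos v \<in> ?D"
    then consider w where "w \<in> A" "pos v = pos w" | e where "e \<in> E" "e \<subseteq> A" "pos v \<in> path_image (\<gamma> e)"
      by (auto simp: drawing_set_def)
    then show False
    proof cases
      case 1
      then show False using that A pos_eq by blast
    next
      case 2
      then have "pos v \<in> pos ` e"
        unfolding im[OF 2(1), symmetric] using that by simp
      then obtain w where "w \<in> e" "pos v = pos w"
        by auto
      then show False using 2 that A pos_eq by blast
    qed
  qed
  have inD: "pos v \<in> ?D" if "v \<in> A" for v
    using that by (simp add: drawing_set_def)
  have leaf: "pos v \<notin> path_image (\<gamma> {x, b})" if "v \<in> V" "{x, b} \<in> E" "v \<noteq> x" "v \<noteq> b" for v x b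
  proof
    assume "pos v \<in> path_image (\<gamma> {x, b})"
    then have "pos v \<in> pos ` {x, b}"
      unfolding im[OF that(2), symmetric] using that by simp
    moreover have "{x, b} \<subseteq> V"
      using sg that by (auto simp: simple_graph_def)
    ultimately show False
      using pos_eq that by auto
  qed
  show thesis
  proof (rule tripod[of ?D g1 g2 g3 "pos x1" "pos x2" "pos x3"])
    show "path_connected ?D"
      by (rule path_connected_drawing[OF pd A(2) sg])
    show "pos x1 \<notin> path_image g2 \<union> path_image g3" "pos x2 \<notin> path_image g1 \<union> path_image g3"
      "pos x3 \<notin> path_image g1 \<union> path_image g2"
      unfolding g1 g2 g3 Un_iff de_Morgan_disj
      by (intro conjI leaf; use x a xV in force)+
    fix z t1 t2 t3
    assume "z \<notin> {pos x1, pos x2, pos x3}" "arc t1" "arc t2" "arc t3"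
    "pathstart t1 = z" "pathstart t2 = z" "pathstart t3 = z"
    "pathfinish t1 = pos x1" "pathfinish t2 = pos x2" "pathfinish t3 = pos x3"
    "path_image t1 \<inter> path_image t2 = {z}" "path_image t1 \<inter> path_image t3 = {z}"
    "path_image t2 \<inter> path_image t3 = {z}"
    and sub: "path_image t1 \<union> path_image t2 \<union> path_image t3
       \<subseteq> ?D \<union> path_image g1 \<union> path_image g2 \<union> path_image g3"
    moreover have "?D \<union> path_image g1 \<union> path_image g2 \<union> path_image g3
      = drawing_set A ({e \<in> E. e \<subseteq> A} \<union> {{x1, a1}, {x2, a2}, {x3, a3}}) pos \<gamma>"
      unfolding g1 g2 g3 drawing_set_def by auto
    ultimately show thesis
      using that[of z t1 t2 t3] by simp
  qed (use g1 g2 g3 a x xV notD inD in auto)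
qed

text \<open>The tripods through \<open>A\<close> and through \<open>B\<close> run along disjoint
  sets of edges and meet only in their leaves. Glued there they form a theta curve with one of the
  points \<open>pos x1\<close>, \<open>pos x2\<close>, \<open>pos x3\<close> in the interior of each
  arc, and all vertices are on the outer frontier.\<close>

lemma outerplanar_K23_free:
  assumes sg: "simple_graph V E" and op: "outerplanar V E"
  shows "K23_free V E"
  unfolding K23_free_def
proof (intro allI impI notI, elim conjE)
  fix A B x1 x2 x3
  assume A: "A \<subseteq> V" "connected_in E A" and B: "B \<subseteq> V" "connected_in E B" and AB: "A \<inter> B = {}"
    and x: "distinct [x1, x2, x3]" "{x1, x2, x3} \<inter> (A \<union> B) = {}"
    and adj: "\<forall>x\<in>{x1, x2, x3}. (\<exists>a\<in>A. {x, a} \<in> E) \<and> (\<exists>b\<in>B. {x, b} \<in> E)"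
  obtain pos \<gamma> where pd: "plane_drawing V E pos \<gamma>"
    and outer: "\<forall>v\<in>V. pos v \<in> frontier (outside (drawing_set V E pos \<gamma>))"
    using op unfolding outerplanar_def by blast
  obtain a1 a2 a3 where a: "a1 \<in> A" "a2 \<in> A" "a3 \<in> A" "{x1, a1} \<in> E" "{x2, a2} \<in> E" "{x3, a3} \<in> E"
    using adj by (metis insertCI)
  obtain b1 b2 b3 where b: "b1 \<in> B" "b2 \<in> B" "b3 \<in> B" "{x1, b1} \<in> E" "{x2, b2} \<in> E" "{x3, b3} \<in> E"
    using adj by (metis insertCI)
  have xV: "x1 \<in> V" "x2 \<in> V" "x3 \<in> V"
    using sg a by (auto simp: simple_graph_def)
  let ?FA = "{e \<in> E. e \<subseteq> A} \<union> {{x1, a1}, {x2, a2}, {x3, a3}}"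
  let ?FB = "{e \<in> E. e \<subseteq> B} \<union> {{x1, b1}, {x2, b2}, {x3, b3}}"
  let ?SA = "drawing_set A ?FA pos \<gamma>" and ?SB = "drawing_set B ?FB pos \<gamma>"
  have xA: "{x1, x2, x3} \<inter> A = {}" and xB: "{x1, x2, x3} \<inter> B = {}"
    using x by auto
  obtain z s1 s2 s3 where z: "z \<notin> {pos x1, pos x2, pos x3}" "arc s1" "arc s2" "arc s3"
    "pathstart s1 = z" "pathstart s2 = z" "pathstart s3 = z"
    "pathfinish s1 = pos x1" "pathfinish s2 = pos x2" "pathfinish s3 = pos x3"
    "path_image s1 \<inter> path_image s2 = {z}" "path_image s1 \<inter> path_image s3 = {z}"
    "path_image s2 \<inter> path_image s3 = {z}"
    and sA: "path_image s1 \<union> path_image s2 \<union> path_image s3 \<subseteq> ?SA"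
    using tripod_in_drawing[OF pd sg A x(1) xA a] by blast
  obtain w t1 t2 t3 where w: "w \<notin> {pos x1, pos x2, pos x3}" "arc t1" "arc t2" "arc t3"
    "pathstart t1 = w" "pathstart t2 = w" "pathstart t3 = w"
    "pathfinish t1 = pos x1" "pathfinish t2 = pos x2" "pathfinish t3 = pos x3"
    "path_image t1 \<inter> path_image t2 = {w}" "path_image t1 \<inter> path_image t3 = {w}"
    "path_image t2 \<inter> path_image t3 = {w}"
    and tB: "path_image t1 \<union> path_image t2 \<union> path_image t3 \<subseteq> ?SB"
    using tripod_in_drawing[OF pd sg B x(1) xB b] by blast
  have two: "card e = 2" if "e \<in> E" for e
    using sg that by (simp add: simple_graph_def)
  \<comment> \<open>Every edge of \<open>?FA\<close> meets \<open>A\<close>, since edges are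
    nonempty, and no edge of \<open>?FB\<close> does.\<close>
  have disj: "?FA \<inter> ?FB = {}"
  proof -
    have "e \<notin> ?FB" if "e \<in> ?FA" for e
    proof
      assume e': "e \<in> ?FB"
      have "e \<in> E" using that a by auto
      then have "e \<noteq> {}" using two by force
      have "e \<inter> A \<noteq> {}" using that a \<open>e \<noteq> {}\<close> by auto
      moreover have "e \<inter> A = {}" using e' b xA AB by auto
      ultimately show False by blast
    qed
    then show ?thesis by blast
  qed
  have "?SA \<inter> ?SB \<subseteq> pos ` ((A \<union> \<Union>?FA) \<inter> (B \<union> \<Union>?FB))"
    using a b disj by (intro drawing_set_Int[OF pd sg A(1) B(1)]) auto
  moreover have "(A \<union> \<Union>?FA) \<inter> (B \<union> \<Union>?FB) \<subseteq> {x1, x2, x3}"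
    using a b AB x by auto
  ultimately have SAB: "?SA \<inter> ?SB \<subseteq> {pos x1, pos x2, pos x3}"
    by auto
  have ends_in: "pathstart g \<in> path_image g" "pathfinish g \<in> path_image g" for g :: "real \<Rightarrow> complex"
    by auto
  have s_in: "pos x1 \<in> path_image s1" "pos x2 \<in> path_image s2" "pos x3 \<in> path_image s3"
    using ends_in(2)[of s1] ends_in(2)[of s2] ends_in(2)[of s3] z by simp_all
  have t_in: "pos x1 \<in> path_image t1" "pos x2 \<in> path_image t2" "pos x3 \<in> path_image t3"
    using ends_in(2)[of t1] ends_in(2)[of t2] ends_in(2)[of t3] w by simp_all
  have s_out: "pos x2 \<notin> path_image s1" "pos x3 \<notin> path_image s1" "pos x1 \<notin> path_image s2"
    "pos x3 \<notin> path_image s2" "pos x1 \<notin> path_image s3" "pos x2 \<notin> path_image s3"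
    using s_in z(1,11,12,13) by (metis IntI insertCI singletonD)+
  have t_out: "pos x2 \<notin> path_image t1" "pos x3 \<notin> path_image t1" "pos x1 \<notin> path_image t2"
    "pos x3 \<notin> path_image t2" "pos x1 \<notin> path_image t3" "pos x2 \<notin> path_image t3"
    using t_in w(1,11,12,13) by (metis IntI insertCI singletonD)+
  have st: "path_image s1 \<inter> path_image t1 \<subseteq> {pos x1}" "path_image s2 \<inter> path_image t2 \<subseteq> {pos x2}"
    "path_image s3 \<inter> path_image t3 \<subseteq> {pos x3}"
    using SAB sA tB s_out by blast+
  have st': "path_image s1 \<inter> path_image t2 = {}" "path_image s1 \<inter> path_image t3 = {}"
    "path_image s2 \<inter> path_image t1 = {}" "path_image s2 \<inter> path_image t3 = {}"
    "path_image s3 \<inter> path_image t1 = {}" "path_image s3 \<inter> path_image t2 = {}"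
    using SAB sA tB s_out t_out by blast+
  let ?c1 = "s1 +++ reversepath t1" and ?c2 = "s2 +++ reversepath t2" and ?c3 = "s3 +++ reversepath t3"
  have im: "path_image ?c1 = path_image s1 \<union> path_image t1" "path_image ?c2 = path_image s2 \<union> path_image t2"
    "path_image ?c3 = path_image s3 \<union> path_image t3"
    using z w by (simp_all add: path_image_join)
  have mono: "?SA \<subseteq> drawing_set V E pos \<gamma>" "?SB \<subseteq> drawing_set V E pos \<gamma>"
    using A B a b unfolding drawing_set_def by blast+
  show False
  proof (rule theta_curve_not_all_on_outer_face[of ?c1 ?c2 ?c3 z w "drawing_set V E pos \<gamma>" "pos x1" "pos x2" "pos x3"])
    show "arc ?c1" "arc ?c2" "arc ?c3"
      using z w st by (auto intro!: arc_join simp: arc_reversepath)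
    show "pathstart ?c1 = z" "pathstart ?c2 = z" "pathstart ?c3 = z"
      "pathfinish ?c1 = w" "pathfinish ?c2 = w" "pathfinish ?c3 = w"
      using z w by simp_all
    show "path_image ?c1 \<inter> path_image ?c2 = {z, w}" "path_image ?c1 \<inter> path_image ?c3 = {z, w}"
      "path_image ?c2 \<inter> path_image ?c3 = {z, w}"
      unfolding im Int_Un_distrib Int_Un_distrib2 z(11-13) w(11-13) st' st'[unfolded Int_commute[of "path_image s1"]
        Int_commute[of "path_image s2"] Int_commute[of "path_image s3"]] by auto
    show "path_image ?c1 \<subseteq> drawing_set V E pos \<gamma>" "path_image ?c2 \<subseteq> drawing_set V E pos \<gamma>"
      "path_image ?c3 \<subseteq> drawing_set V E pos \<gamma>"
      unfolding im using sA tB mono by blast+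
    show "pos x1 \<in> path_image ?c1 - {z, w}" "pos x2 \<in> path_image ?c2 - {z, w}" "pos x3 \<in> path_image ?c3 - {z, w}"
      unfolding im using s_in z(1) w(1) by auto
    show "{pos x1, pos x2, pos x3} \<subseteq> frontier (outside (drawing_set V E pos \<gamma>))"
      using outer xV by auto
  qed
qed

section \<open>Layers of a K23-free graph\<close>

lemma connected_in_Un:
  assumes A: "connected_in E A" and B: "connected_in E B"
    and ab: "a \<in> A" "b \<in> B" "a = b \<or> {a, b} \<in> E"
  shows "connected_in E (A \<union> B)"
proof -
  let ?R = "\<lambda>A. {(x, y). x \<in> A \<and> y \<in> A \<and> {x, y} \<in> E}\<^sup>*"
  have mono: "?R A \<subseteq> ?R (A \<union> B)" "?R B \<subseteq> ?R (A \<union> B)"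
    by (auto intro!: rtrancl_mono)
  have "(a, b) \<in> ?R (A \<union> B)" "(b, a) \<in> ?R (A \<union> B)"
    using ab by (auto simp: insert_commute)
  moreover have "(x, a) \<in> ?R (A \<union> B) \<and> (a, x) \<in> ?R (A \<union> B)" if "x \<in> A" for x
    using A ab that mono unfolding connected_in_def by blast
  moreover have "(x, b) \<in> ?R (A \<union> B) \<and> (b, x) \<in> ?R (A \<union> B)" if "x \<in> B" for x
    using B ab that mono unfolding connected_in_def by blast
  ultimately show ?thesis
    unfolding connected_in_def by (meson UnE rtrancl_trans)
qed

lemma connected_in_singleton: "connected_in E {x}"
  by (simp add: connected_in_def)

lemma connected_in_insert:
  "connected_in E A \<Longrightarrow> a \<in> A \<Longrightarrow> {x, a} \<in> E \<Longrightarrow> connected_in E (insert x A)"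
  using connected_in_Un[OF connected_in_singleton[of E x], of A x a] by simp

lemma connected_in_successively:
  "successively (\<lambda>x y. {x, y} \<in> E) xs \<Longrightarrow> connected_in E (set xs)"
proof (induction xs)
  case (Cons x xs)
  then show ?case
    using connected_in_insert[of E "set xs" "hd xs" x]
    by (cases xs) (auto simp: connected_in_singleton)
qed (simp add: connected_in_def)

lemma card_le_two:
  assumes "\<And>x y z. distinct [x, y, z] \<Longrightarrow> {x, y, z} \<subseteq> S \<Longrightarrow> False"
  shows "card S \<le> 2"
proof (rule ccontr)
  assume "\<not> card S \<le> 2"
  then obtain T where "T \<subseteq> S" "card T = 3"
    using obtain_subset_with_card_n[of 3 S] by force
  then obtain x y z where "T = {x, y, z}" "x \<noteq> y" "x \<noteq> z" "y \<noteq> z"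
    by (auto simp: card_3_iff)
  then show False
    using assms[of x y z] \<open>T \<subseteq> S\<close> by simp
qed

locale K23_free_graph =
  fixes V :: "'a set" and E :: "'a set set"
  assumes simple: "simple_graph V E" and K23: "K23_free V E"
begin

lemma edge_in: "{u, v} \<in> E \<Longrightarrow> u \<in> V \<and> v \<in> V \<and> u \<noteq> v"
  using simple by (auto simp: simple_graph_def)

lemma edge_sym: "{u, v} \<in> E \<Longrightarrow> {v, u} \<in> E"
  by (simp add: insert_commute)

lemma no_K23:
  assumes "A \<subseteq> V" "B \<subseteq> V" "connected_in E A" "connected_in E B" "A \<inter> B = {}"
    and "distinct [x1, x2, x3]" "{x1, x2, x3} \<inter> (A \<union> B) = {}"
    and "\<And>x. x \<in> {x1, x2, x3} \<Longrightarrow> \<exists>a\<in>A. {x, a} \<in> E" "\<And>x. x \<in> {x1, x2, x3} \<Longrightarrow> \<exists>b\<in>B. {x, b} \<in> E"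
  shows False
  using K23[unfolded K23_free_def, rule_format, of A B x1 x2 x3] assms by blast

text \<open>
  The third vertex of the larger side may also be a connected set \<open>C\<close>: walk through \<open>C\<close> from \<open>B\<close>
  to the first neighbor of \<open>A\<close>, adding the vertices passed to \<open>B\<close>.
\<close>

lemma no_K23_set:
  assumes A: "A \<subseteq> V" "connected_in E A" and B: "B \<subseteq> V" "connected_in E B"
    and C: "C \<subseteq> V" "connected_in E C" and disj: "A \<inter> B = {}" "A \<inter> C = {}" "B \<inter> C = {}"
    and x: "x1 \<noteq> x2" "{x1, x2} \<inter> (A \<union> B \<union> C) = {}"
    and adj: "\<And>x. x \<in> {x1, x2} \<Longrightarrow> \<exists>a\<in>A. {x, a} \<in> E" "\<And>x. x \<in> {x1, x2} \<Longrightarrow> \<exists>b\<in>B. {x, b} \<in> E"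
    and d: "d \<in> C" "a \<in> A" "{d, a} \<in> E" and e: "e \<in> C" "b \<in> B" "{e, b} \<in> E"
  shows False
proof -
  define N where "N = {c \<in> C. \<not> (\<exists>a\<in>A. {c, a} \<in> E)}"
  have grow: "connected_in E (insert z B') \<and> z \<in> N"
    if B': "B \<subseteq> B'" "B' \<subseteq> B \<union> N" "connected_in E B'" and z: "z \<in> C" "y \<in> B'" "{z, y} \<in> E" for B' y z
  proof
    show "connected_in E (insert z B')"
      using connected_in_insert B' z by metis
    show "z \<in> N"
    proof (rule ccontr)
      \<comment> \<open>A vertex \<open>z\<close> outside \<open>N\<close> sees both
        \<open>A\<close> and \<open>B'\<close>, so it is the third vertex of a \<open>K23\<close>
        next to \<open>x1\<close> and \<open>x2\<close>.\<close>
      assume zN: "z \<notin> N"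
      then have za: "\<exists>a\<in>A. {z, a} \<in> E"
        using z by (simp add: N_def)
      have NC: "N \<subseteq> C" by (auto simp: N_def)
      show False
      proof (rule no_K23[of A B' x1 x2 z])
        show "A \<subseteq> V" "B' \<subseteq> V" "connected_in E A" "connected_in E B'"
          using A B C(1) B' NC by (simp_all, blast)
        have "B' \<subseteq> B \<union> C" using B' NC by blast
        then show "A \<inter> B' = {}" using disj by blast
        show "distinct [x1, x2, z]" using x z by auto
        have "z \<notin> B'" using B' disj z zN by blast
        then show "{x1, x2, z} \<inter> (A \<union> B') = {}"
          using \<open>B' \<subseteq> B \<union> C\<close> disj x z by blast
        fix w assume w: "w \<in> {x1, x2, z}"
        show "\<exists>a\<in>A. {w, a} \<in> E" using w adj(1) za by auto
        show "\<exists>b\<in>B'. {w, b} \<in> E"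
        proof (cases "w = z")
          case True
          then show ?thesis using z by blast
        next
          case False
          then have "w \<in> {x1, x2}" using w by blast
          then show ?thesis using adj(2) B' by blast
        qed
      qed
    qed
  qed
  have "(e, d) \<in> {(x, y). x \<in> C \<and> y \<in> C \<and> {x, y} \<in> E}\<^sup>*"
    using C d e by (simp add: connected_in_def)
  then have "\<exists>B'. B \<subseteq> B' \<and> B' \<subseteq> B \<union> N \<and> connected_in E B' \<and> d \<in> B'"
  proof (induction rule: rtrancl_induct)
    case base
    then show ?case
      using grow[of B e b] B e by (intro exI[of _ "insert e B"]) auto
  next
    case (step y z)
    then obtain B' where B': "B \<subseteq> B'" "B' \<subseteq> B \<union> N" "connected_in E B'" "y \<in> B'" by blast
    then have "connected_in E (insert z B') \<and> z \<in> N"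
      using step.hyps edge_sym by (intro grow[of B' z y]) auto
    then show ?case
      using B' by (intro exI[of _ "insert z B'"]) auto
  qed
  then have "d \<in> B \<union> N" by blast
  then show False using d disj by (auto simp: N_def)
qed

section \<open>Distance layers\<close>

definition adjacency :: "('a \<times> 'a) set" where
  "adjacency = {(x, y). {x, y} \<in> E}"

text \<open>The choice depends only on the set of reachable vertices, so it is the same throughout a
  component. A vertex without edges is its own root.\<close>

definition rt :: "'a \<Rightarrow> 'a" where
  "rt v = (SOME x. (v, x) \<in> adjacency\<^sup>*)"

text \<open>The distance from the root of the component. Anything outside \<open>V\<close> is its
  own root and has level 0, so a positive level implies membership in \<open>V\<close>.\<close>

definition lev :: "'a \<Rightarrow> nat" where
  "lev v = (LEAST n. (rt v, v) \<in> adjacency ^^ n)"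

definition parents :: "'a \<Rightarrow> 'a set" where
  "parents v = {u. {u, v} \<in> E \<and> lev v = Suc (lev u)}"

text \<open>The set that plays the role of one contracted vertex: it is connected, and for positive
  \<open>i\<close> each vertex of level \<open>i\<close> with root \<open>r\<close> has a neighbor
  in it.\<close>

definition below :: "'a \<Rightarrow> nat \<Rightarrow> 'a set" where
  "below r i = {v \<in> V. rt v = r \<and> lev v < i}"

lemma adjacency_sym: "(u, v) \<in> adjacency\<^sup>* \<Longrightarrow> (v, u) \<in> adjacency\<^sup>*"
proof -
  have "sym adjacency" by (auto simp: sym_def adjacency_def insert_commute)
  then show "(u, v) \<in> adjacency\<^sup>* \<Longrightarrow> (v, u) \<in> adjacency\<^sup>*"
    by (meson sym_rtrancl symD)
qed

lemma rt_reachable: "(rt v, v) \<in> adjacency\<^sup>*"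
proof -
  have "(v, rt v) \<in> adjacency\<^sup>*"
    unfolding rt_def by (rule someI[of _ v]) simp
  then show ?thesis by (rule adjacency_sym)
qed

lemma rt_edge:
  assumes "{u, v} \<in> E"
  shows "rt u = rt v"
proof -
  have "(u, v) \<in> adjacency\<^sup>*" "(v, u) \<in> adjacency\<^sup>*"
    using assms edge_sym by (auto simp: adjacency_def)
  then have "(u, x) \<in> adjacency\<^sup>* \<longleftrightarrow> (v, x) \<in> adjacency\<^sup>*" for x
    by (meson rtrancl_trans)
  then show ?thesis by (simp add: rt_def)
qed

lemma lev_walk: "(rt v, v) \<in> adjacency ^^ lev v"
  unfolding lev_def using rtrancl_imp_relpow[OF rt_reachable] by (rule LeastI_ex)

lemma lev_edge: "{u, v} \<in> E \<Longrightarrow> lev v \<le> Suc (lev u)"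
proof -
  assume uv: "{u, v} \<in> E"
  then have "(rt v, v) \<in> adjacency ^^ Suc (lev u)"
    using lev_walk[of u] rt_edge[OF uv] by (auto simp: adjacency_def)
  then show ?thesis unfolding lev_def[of v] by (rule Least_le)
qed

lemma lev_0: "lev v = 0 \<Longrightarrow> v = rt v"
  using lev_walk[of v] by simp

lemma lev_cases:
  assumes "{u, v} \<in> E"
  obtains "lev u = lev v" | "u \<in> parents v" | "v \<in> parents u"
proof -
  have "{v, u} \<in> E" by (rule edge_sym[OF assms])
  then have "lev u = lev v \<or> u \<in> parents v \<or> v \<in> parents u"
    using assms lev_edge[of u v] lev_edge[of v u] by (auto simp: parents_def)
  then show thesis using that by blast
qed

lemma parentsD: "u \<in> parents v \<Longrightarrow> {u, v} \<in> E \<and> u \<in> V \<and> v \<in> V \<and> rt u = rt v \<and> lev v = Suc (lev u)"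
  using edge_in rt_edge by (auto simp: parents_def)

lemma parents_nonempty:
  assumes "lev v > 0"
  shows "\<exists>u. u \<in> parents v"
proof -
  obtain n where n: "lev v = Suc n" using assms gr0_implies_Suc by blast
  then have "(rt v, v) \<in> adjacency ^^ Suc n" using lev_walk[of v] by simp
  then obtain u where u: "(rt v, u) \<in> adjacency ^^ n" "{u, v} \<in> E"
    by (auto simp: adjacency_def elim: relpow_Suc_E)
  then have "lev u \<le> n"
    using rt_edge[OF u(2)] unfolding lev_def[of u] by (simp add: Least_le)
  then show ?thesis
    using u n lev_edge[of u v] by (auto simp: parents_def)
qed

text \<open>Level 0 of a component is the root alone. The positivity obtained here guarantees all
  vertices of the layer a neighbor in \<open>below\<close>.\<close>

lemma lev_pos:
  assumes "rt u = rt v" "lev u = lev v" "u \<noteq> v"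
  shows "lev v > 0"
  using assms lev_0[of u] lev_0[of v] by fastforce

text \<open>Following parents leads to the root through ever smaller levels, hence without leaving
  the set.\<close>

lemma below_connected: "connected_in E (below r i)"
proof -
  let ?R = "{(x, y). x \<in> below r i \<and> y \<in> below r i \<and> {x, y} \<in> E}"
  have to_root: "(v, r) \<in> ?R\<^sup>*" if "v \<in> below r i" for v
    using that
  proof (induction "lev v" arbitrary: v)
    case 0
    then show ?case using lev_0[of v] by (simp add: below_def)
  next
    case (Suc n)
    obtain u where u: "u \<in> parents v" using parents_nonempty[of v] Suc by auto
    then have "u \<in> below r i" "n = lev u"
      using Suc parentsD[OF u] by (auto simp: below_def)
    then show ?case
      using Suc parentsD[OF u] edge_sym by (intro converse_rtrancl_into_rtrancl[of v u]) auto
  qed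
  have "sym ?R" by (auto simp: sym_def insert_commute)
  then have "(r, v) \<in> ?R\<^sup>*" if "v \<in> below r i" for v
    using to_root[OF that] by (meson sym_rtrancl symD)
  then show ?thesis
    unfolding connected_in_def using to_root by (meson rtrancl_trans)
qed

lemma below_subset: "below r i \<subseteq> V"
  by (auto simp: below_def)

lemma parent_below:
  assumes "lev v > 0"
  shows "\<exists>u\<in>below (rt v) (lev v). {v, u} \<in> E"
proof -
  obtain u where "u \<in> parents v" using parents_nonempty assms by blast
  then show ?thesis using parentsD[of u v] edge_sym by (auto simp: below_def)
qed

lemma not_below: "i \<le> lev v \<Longrightarrow> v \<notin> below r i"
  by (simp add: below_def)

text \<open>Three parents would be the larger side of a \<open>K23\<close> whose smaller side is
  their child \<open>v\<close> and the set below their layer.\<close>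

lemma card_parents: "card (parents v) \<le> 2"
proof (rule card_le_two)
  fix x y z assume d: "distinct [x, y, z]" and p: "{x, y, z} \<subseteq> parents v"
  have lev: "lev w = lev x" "rt w = rt x" if "w \<in> {x, y, z}" for w
    using that p parentsD by (metis Suc_inject subsetD insertI1)+
  have pos: "lev x > 0"
    using lev_pos[of y x] lev[of y] d by auto
  have v: "v \<in> V" "lev v = Suc (lev x)"
    using p parentsD[of x v] by auto
  show False
  proof (rule no_K23[of "{v}" "below (rt x) (lev x)" x y z])
    show "\<exists>a\<in>{v}. {w, a} \<in> E" if "w \<in> {x, y, z}" for w
      using that p parentsD by blast
    show "\<exists>b\<in>below (rt x) (lev x). {w, b} \<in> E" if "w \<in> {x, y, z}" for w
      using parent_below[of w] lev[OF that] pos by simp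
    show "{x, y, z} \<inter> ({v} \<union> below (rt x) (lev x)) = {}"
      using v(2) lev(1)[of y] lev(1)[of z] by (auto simp: below_def)
  qed (use v d below_subset below_connected connected_in_singleton in \<open>auto simp: below_def\<close>)
qed

text \<open>The same configuration as for three parents, with \<open>v\<close> now in the layer of
  its three neighbors.\<close>

lemma card_level_neighbors: "card {u. {u, v} \<in> E \<and> lev u = lev v} \<le> 2"
proof (rule card_le_two)
  fix x y z assume d: "distinct [x, y, z]" and p: "{x, y, z} \<subseteq> {u. {u, v} \<in> E \<and> lev u = lev v}"
  have lev: "lev w = lev v" "rt w = rt v" "w \<noteq> v" if "w \<in> {x, y, z}" for w
    using that p rt_edge[of w v] edge_in[of w v] by auto
  have pos: "lev v > 0" and v: "v \<in> V"
    using lev_pos[of x v] lev[of x] p edge_in by auto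
  show False
  proof (rule no_K23[of "{v}" "below (rt v) (lev v)" x y z])
    show "\<exists>a\<in>{v}. {w, a} \<in> E" if "w \<in> {x, y, z}" for w
      using that p by blast
    show "\<exists>b\<in>below (rt v) (lev v). {w, b} \<in> E" if "w \<in> {x, y, z}" for w
      using parent_below[of w] lev[OF that] pos by simp
    show "{x, y, z} \<inter> ({v} \<union> below (rt v) (lev v)) = {}"
      using lev(1)[of x] lev(1)[of y] lev(1)[of z] lev(3)[of x] lev(3)[of y] lev(3)[of z] by (auto simp: below_def)
  qed (use v d below_subset below_connected connected_in_singleton in \<open>auto simp: below_def\<close>)
qed

definition two_parents :: "'a \<Rightarrow> bool" where
  "two_parents v \<longleftrightarrow> (\<exists>p\<in>parents v. \<exists>p'\<in>parents v. p \<noteq> p')"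

text \<open>Three such children would be the larger side of a \<open>K23\<close>. One vertex of the
  smaller side is \<open>u\<close>; the other consists of the further parents and the set below the
  layer of \<open>u\<close>. The further parents may coincide, and each has a neighbor below, so
  this set is connected.\<close>

lemma card_two_parent_children: "card {w. two_parents w \<and> u \<in> parents w} \<le> 2"
proof (rule card_le_two)
  fix x y z assume d: "distinct [x, y, z]" and p: "{x, y, z} \<subseteq> {w. two_parents w \<and> u \<in> parents w}"
  have "\<exists>p. p \<in> parents w \<and> p \<noteq> u" if "w \<in> {x, y, z}" for w
  proof -
    have "two_parents w" using that p by blast
    then show ?thesis unfolding two_parents_def by metis
  qed
  then obtain q where q: "\<And>w. w \<in> {x, y, z} \<Longrightarrow> q w \<in> parents w \<and> q w \<noteq> u" by metis
  have w: "u \<in> parents w" if "w \<in> {x, y, z}" for w using that p by blast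
  have lev_q: "lev (q w) = lev u" "rt (q w) = rt u" "q w \<in> V" if "w \<in> {x, y, z}" for w
    using parentsD[of "q w" w] parentsD[of u w] q[OF that] w[OF that] by auto
  have pos: "lev u > 0" and u: "u \<in> V"
    using lev_pos[of "q x" u] lev_q[of x] q[of x] parentsD[OF w[of x]] by auto
  let ?B = "below (rt u) (lev u)"
  have q_below: "\<exists>b\<in>?B. {q w, b} \<in> E" if "w \<in> {x, y, z}" for w
    using parent_below[of "q w"] lev_q[OF that] pos by simp
  have ins: "connected_in E (insert (q w) B)" if "connected_in E B" "?B \<subseteq> B" "w \<in> {x, y, z}" for B w
    using q_below[OF that(3)] that connected_in_insert by (metis subsetD)
  show False
  proof (rule no_K23[of "{u}" "insert (q x) (insert (q y) (insert (q z) ?B))" x y z])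
    show "connected_in E (insert (q x) (insert (q y) (insert (q z) ?B)))"
      using below_connected by (intro ins) auto
    show "\<exists>a\<in>{u}. {v, a} \<in> E" if "v \<in> {x, y, z}" for v
      using parentsD[OF w[OF that]] edge_sym by blast
    show "\<exists>b\<in>insert (q x) (insert (q y) (insert (q z) ?B)). {v, b} \<in> E" if "v \<in> {x, y, z}" for v
      using q[OF that] parentsD[of "q v" v] that edge_sym by blast
    have "lev v = Suc (lev u)" if "v \<in> {x, y, z}" for v
      using parentsD[OF w[OF that]] by simp
    then show "{x, y, z} \<inter> ({u} \<union> insert (q x) (insert (q y) (insert (q z) ?B))) = {}"
      using lev_q by (force simp: below_def)
    show "{u} \<inter> insert (q x) (insert (q y) (insert (q z) ?B)) = {}"
      using q by (fastforce simp: below_def)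
    show "insert (q x) (insert (q y) (insert (q z) ?B)) \<subseteq> V"
      using lev_q below_subset by auto
  qed (use u d connected_in_singleton in auto)
qed

section \<open>Cycles of edges within a layer\<close>

definition level_edges :: "'a set set" where
  "level_edges = {e \<in> E. \<exists>u v. e = {u, v} \<and> lev u = lev v}"

lemma level_edges_iff: "{u, v} \<in> level_edges \<longleftrightarrow> {u, v} \<in> E \<and> lev u = lev v"
  by (auto simp: level_edges_def doubleton_eq_iff)

lemma successively_level:
  assumes "successively (\<lambda>x y. lev x = lev y \<and> rt x = rt y) (x # xs)" "y \<in> set xs"
  shows "lev y = lev x \<and> rt y = rt x"
  using assms by (induction xs arbitrary: x) auto

text \<open>In a longer cycle the neighbors \<open>y1\<close> and \<open>yk\<close> of
  \<open>y0\<close> are adjacent to \<open>y0\<close> on one side and to the path \<open>mid\<close>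
  on the other. The set below the layer is adjacent to both and serves as the third, connected
  vertex of the larger side. In a triangle \<open>mid\<close> would be empty.\<close>

lemma level_cycle_length:
  assumes "distinct ys" "successively (\<lambda>x y. {x, y} \<in> level_edges) ys" "{last ys, hd ys} \<in> level_edges"
  shows "length ys \<le> 3"
proof (rule ccontr)
  assume "\<not> length ys \<le> 3"
  then have "Suc (Suc (Suc (Suc 0))) \<le> length ys" by simp
  then obtain y0 y1 y2 y3 zs where "ys = y0 # y1 # y2 # y3 # zs"
    by (auto simp: Suc_le_length_iff)
  then obtain mid yk where ys: "ys = y0 # y1 # mid @ [yk]" "mid \<noteq> []"
    by (metis append_butlast_last_id butlast.simps(2) list.distinct(1))
  have lev: "lev w = lev y0" "rt w = rt y0" if "w \<in> set (y1 # mid @ [yk])" for w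
  proof -
    have "successively (\<lambda>x y. lev x = lev y \<and> rt x = rt y) ys"
      using assms(2) by (rule successively_mono) (auto simp: level_edges_iff rt_edge)
    then show "lev w = lev y0" "rt w = rt y0"
      using successively_level[of y0 "y1 # mid @ [yk]" w] that ys by auto
  qed
  have y1: "{y1, y0} \<in> E" and yk: "{yk, y0} \<in> E" and edges: "successively (\<lambda>x y. {x, y} \<in> E) (y1 # mid @ [yk])"
    using assms(2,3) ys edge_sym successively_mono[OF assms(2), of "\<lambda>x y. {x, y} \<in> E"]
    by (auto simp: level_edges_iff)
  have y1': "{y1, hd mid} \<in> E" and yk': "{last mid, yk} \<in> E" and mid: "successively (\<lambda>x y. {x, y} \<in> E) mid"
    using edges ys(2) by (auto simp: successively_Cons successively_append_iff)
  have V: "y0 \<in> V" "y1 \<in> V" "yk \<in> V"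
    using y1 yk edge_in by auto
  have pos: "lev y0 > 0"
    using lev_pos[of y1 y0] lev[of y1] edge_in[OF y1] by simp
  let ?C = "below (rt y0) (lev y0)"
  have m: "hd mid \<in> set mid" "last mid \<in> set mid" using ys by auto
  obtain d where d: "d \<in> ?C" "{d, y0} \<in> E"
    using parent_below[OF pos] edge_sym by blast
  obtain e where e: "e \<in> ?C" "{e, hd mid} \<in> E"
    using parent_below[of "hd mid"] lev[of "hd mid"] m pos edge_sym by auto
  have midV: "set mid \<subseteq> V"
  proof
    fix w assume w: "w \<in> set mid"
    show "w \<in> V"
    proof -
      \<comment> \<open>A vertex of positive level has a parent, so it is an end of an edge.\<close>
      have "lev w > 0" using lev[of w] w pos by simp
      then show ?thesis using parents_nonempty parentsD by blast
    qed
  qed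
  show False
  proof (rule no_K23_set[of "{y0}" "set mid" ?C y1 yk d y0 e "hd mid"])
    show "connected_in E (set mid)" using mid by (rule connected_in_successively)
    show "\<exists>a\<in>{y0}. {x, a} \<in> E" if "x \<in> {y1, yk}" for x using that y1 yk by auto
    show "\<exists>b\<in>set mid. {x, b} \<in> E" if "x \<in> {y1, yk}" for x
      using that y1' yk' m edge_sym by blast
    show "set mid \<inter> ?C = {}" using lev by (auto simp: below_def)
    show "{y1, yk} \<inter> ({y0} \<union> set mid \<union> ?C) = {}"
      using lev[of y1] lev[of yk] assms(1) ys by (auto simp: below_def)
  qed (use d e m V midV assms(1) ys below_subset below_connected connected_in_singleton in \<open>auto simp: below_def\<close>)
qed

section \<open>Vertices sharing a parent\<close>

definition share_parent :: "'a \<Rightarrow> 'a \<Rightarrow> bool" where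
  "share_parent v w \<longleftrightarrow> v \<noteq> w \<and> parents v \<inter> parents w \<noteq> {}"

lemma share_parent_level: "share_parent v w \<Longrightarrow> lev v = lev w \<and> rt v = rt w"
  using parentsD unfolding share_parent_def by (metis disjoint_iff)

lemma connected_in_family:
  assumes "xs \<noteq> []" "successively share_parent xs"
  shows "connected_in E (\<Union>x\<in>set xs. insert x (parents x))"
  using assms
proof (induction xs)
  case (Cons x xs)
  have star: "connected_in E (insert x P)" if P: "P \<subseteq> parents x" for P
  proof -
    have "finite P"
      using P simple parentsD finite_subset[of P V] by (auto simp: simple_graph_def)
    then show ?thesis using P
    proof (induction P)
      case (insert p P)
      then have "connected_in E (insert p (insert x P))"
        using parentsD[of p x] connected_in_insert[of E "insert x P" x p] by auto
      then show ?case by (simp add: insert_commute)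
    qed (simp add: connected_in_singleton)
  qed
  show ?case
  proof (cases xs)
    case Nil
    then show ?thesis using star[of "parents x"] by simp
  next
    case (Cons y zs)
    then obtain u where "u \<in> parents x" "u \<in> parents y"
      using Cons.prems by (auto simp: share_parent_def)
    then have "connected_in E (insert x (parents x) \<union> (\<Union>x\<in>set xs. insert x (parents x)))"
      using Cons.IH Cons.prems Cons star[of "parents x"]
      by (intro connected_in_Un[of E _ _ u u]) (auto simp: successively_Cons)
    then show ?thesis by simp
  qed
qed simp

text \<open>On a cycle let \<open>u\<close> be a common parent of \<open>y0\<close> and
  \<open>y1\<close>. The remaining vertices \<open>zs\<close> with all their parents form a
  connected set that avoids \<open>u\<close> and has neighbors of both \<open>y0\<close> and
  \<open>y1\<close>. The set below the layer of \<open>u\<close> is again the third vertex; it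
  reaches \<open>u\<close> directly and the rest through the parent \<open>t\<close>.\<close>

lemma share_parent_acyclic:
  assumes "distinct ys" "\<And>y. y \<in> set ys \<Longrightarrow> two_parents y" "length ys \<ge> 3"
    "successively share_parent ys"
  shows "\<not> share_parent (last ys) (hd ys)"
proof
  assume last: "share_parent (last ys) (hd ys)"
  obtain y0 y1 zs where ys: "ys = y0 # y1 # zs" "zs \<noteq> []"
    using assms(3) by (cases ys; cases "tl ys"; cases "tl (tl ys)") auto
  have lev: "lev w = lev y0" "rt w = rt y0" if "w \<in> set (y1 # zs)" for w
  proof -
    have "successively (\<lambda>x y. lev x = lev y \<and> rt x = rt y) ys"
      using assms(4) by (rule successively_mono) (auto dest: share_parent_level)
    then show "lev w = lev y0" "rt w = rt y0"
      using successively_level[of y0 "y1 # zs" w] that ys by auto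
  qed
  have zs: "successively share_parent zs" and y1: "share_parent y1 (hd zs)" and y0: "share_parent (last zs) y0"
    using assms(4) last ys by (auto simp: successively_Cons)
  obtain u where u: "u \<in> parents y0" "u \<in> parents y1"
    using assms(4) ys by (auto simp: share_parent_def)
  obtain s where s: "s \<in> parents y0" "s \<in> parents (last zs)"
    using y0 by (auto simp: share_parent_def)
  obtain t where t: "t \<in> parents y1" "t \<in> parents (hd zs)"
    using y1 by (auto simp: share_parent_def)
  have z: "hd zs \<in> set zs" "last zs \<in> set zs" using ys by auto
  have lev_u: "lev y0 = Suc (lev u)" "rt y0 = rt u" "u \<in> V" using parentsD[OF u(1)] by auto
  \<comment> \<open>\<open>y0\<close> and \<open>y1\<close> already exhaust the two two-parent
    children that \<open>u\<close> can have.\<close>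
  have u_z: "u \<notin> parents w" if "w \<in> set zs" for w
  proof
    assume "u \<in> parents w"
    then have "{y0, y1, w} \<subseteq> {w. two_parents w \<and> u \<in> parents w}"
      using u assms(2) ys that by auto
    moreover have "y0 \<noteq> y1" "y0 \<noteq> w" "y1 \<noteq> w" using assms(1) ys that by auto
    then have "card {y0, y1, w} = 3" by simp
    moreover have "{w. two_parents w \<and> u \<in> parents w} \<subseteq> V"
      using parentsD by blast
    then have "finite {w. two_parents w \<and> u \<in> parents w}"
      using simple finite_subset by (auto simp: simple_graph_def)
    ultimately show False
      using card_two_parent_children[of u] card_mono[of "{w. two_parents w \<and> u \<in> parents w}" "{y0, y1, w}"] by simp
  qed
  have lev_p: "lev p = lev u \<and> rt p = rt u" if "w \<in> set zs" "p \<in> parents w" for w p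
    using parentsD[OF that(2)] lev[of w] that(1) lev_u by auto
  have "t \<noteq> u" using t u_z z by blast
  moreover have lev_t: "lev t = lev u" "rt t = rt u" using lev_p[OF z(1) t(2)] by auto
  ultimately have pos: "lev u > 0" using lev_pos by blast
  let ?C = "below (rt u) (lev u)" and ?B = "\<Union>x\<in>set zs. insert x (parents x)"
  obtain d where d: "d \<in> ?C" "{d, u} \<in> E"
    using parent_below[OF pos] edge_sym by blast
  obtain e where e: "e \<in> ?C" "{e, t} \<in> E"
    using parent_below[of t] lev_t pos edge_sym by auto
  have zV: "w \<in> V" if "w \<in> set zs" for w
    using lev[of w] lev_u that parents_nonempty[of w] parentsD by auto
  have B_lev: "lev w \<ge> lev u" if "w \<in> ?B" for w
    using that lev lev_u lev_p by fastforce
  have y_notB: "y \<notin> ?B" if "y \<in> {y0, y1}" for y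
  proof
    assume "y \<in> ?B"
    then consider "y \<in> set zs" | w where "w \<in> set zs" "y \<in> parents w" by blast
    then show False
    proof cases
      case 1
      then show ?thesis using that assms(1) ys by auto
    next
      case 2
      then show ?thesis using lev_p[OF 2] lev[of y1] lev_u that by auto
    qed
  qed
  show False
  proof (rule no_K23_set[of "{u}" ?B ?C y0 y1 d u e t])
    show "connected_in E ?B" using connected_in_family[OF ys(2) zs] .
    show "\<exists>a\<in>{u}. {x, a} \<in> E" if "x \<in> {y0, y1}" for x
      using that u parentsD edge_sym by blast
    show "\<exists>b\<in>?B. {x, b} \<in> E" if "x \<in> {y0, y1}" for x
      using that s t z parentsD[OF s(1)] parentsD[OF t(1)] edge_sym by blast
    show "?B \<subseteq> V" using zV parentsD by blast
    have "u \<notin> set zs" using lev(1)[of u] lev_u by auto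
    then show "{u} \<inter> ?B = {}" using u_z by blast
    show "?B \<inter> ?C = {}" using B_lev not_below by blast
    have "y \<noteq> u \<and> y \<notin> ?C" if "y \<in> {y0, y1}" for y
      using that lev(1)[of y1] lev_u by (auto simp: below_def)
    then show "{y0, y1} \<inter> ({u} \<union> ?B \<union> ?C) = {}"
      using y_notB by blast
    show "{u} \<inter> ?C = {}" by (auto simp: below_def)
    show "t \<in> ?B" using t z by blast
  qed (use d e lev_u assms(1) ys below_subset below_connected connected_in_singleton in auto)
qed

end

section \<open>Coloring paths and short cycles\<close>

text \<open>All neighbors in \<open>S\<close> of the first vertex \<open>x\<close> of a longest path
  lie on that path. One of them is not the successor \<open>w\<close> of \<open>x\<close>, and it
  closes a cycle of length at least three.\<close>

lemma min_degree_two_cycle: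
  assumes S: "finite S" "S \<noteq> {}" and sym: "\<And>x y. R x y \<Longrightarrow> R y x" and irrefl: "\<And>x. \<not> R x x"
    and deg: "\<And>x. x \<in> S \<Longrightarrow> \<exists>y\<in>S. \<exists>z\<in>S. y \<noteq> z \<and> R x y \<and> R x z"
  obtains ys where "distinct ys" "set ys \<subseteq> S" "length ys \<ge> 3" "successively R ys" "R (last ys) (hd ys)"
proof -
  let ?P = "\<lambda>xs. distinct xs \<and> set xs \<subseteq> S \<and> xs \<noteq> [] \<and> successively R xs"
  obtain s where "s \<in> S" using S by blast
  then have "?P [s]" by simp
  moreover have "length xs < Suc (card S)" if "?P xs" for xs
    using that S card_mono[of S "set xs"] distinct_card[of xs] by simp
  ultimately obtain xs where xs: "?P xs" and max: "\<And>zs. ?P zs \<Longrightarrow> length zs \<le> length xs"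
    using ex_has_greatest_nat[of ?P "[s]" length "Suc (card S)"] by auto
  then obtain x xs' where xs_eq: "xs = x # xs'"
    by (cases xs) auto
  then have "x \<in> S" using xs by simp
  have nbr: "y \<in> set xs'" if "y \<in> S" "R x y" for y
  proof (rule ccontr)
    assume "y \<notin> set xs'"
    then have "?P (y # xs)"
      using xs xs_eq that sym irrefl by auto
    then show False using max[of "y # xs"] by simp
  qed
  obtain w xs'' where xs'_eq: "xs' = w # xs''"
    using deg[OF \<open>x \<in> S\<close>] nbr by (cases xs') auto
  obtain y where y: "y \<in> S" "R x y" "y \<noteq> w"
    using deg[OF \<open>x \<in> S\<close>] by metis
  then obtain us vs where "xs'' = us @ y # vs"
    using nbr[of y] xs'_eq by (auto simp: in_set_conv_decomp)
  then have eq: "xs = (x # w # us @ [y]) @ vs"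
    using xs_eq xs'_eq by simp
  show thesis
  proof
    show "distinct (x # w # us @ [y])" "set (x # w # us @ [y]) \<subseteq> S"
      using xs unfolding eq by auto
    show "successively R (x # w # us @ [y])"
      using xs unfolding eq successively_append_iff by blast
    show "R (last (x # w # us @ [y])) (hd (x # w # us @ [y]))"
      using y sym by simp
  qed simp
qed

text \<open>Without cycles some vertex has at most one neighbor in \<open>W\<close>. It is removed,
  the rest is colored by induction, and the vertex gets a color different from that
  neighbor's.\<close>

lemma acyclic_two_coloring:
  fixes R :: "'a \<Rightarrow> 'a \<Rightarrow> bool"
  assumes "finite W" and sym: "\<And>x y. R x y \<Longrightarrow> R y x" and irrefl: "\<And>x. \<not> R x x"
    and acyc: "\<And>ys. distinct ys \<Longrightarrow> set ys \<subseteq> W \<Longrightarrow> length ys \<ge> 3 \<Longrightarrow> successively R ys \<Longrightarrow> \<not> R (last ys) (hd ys)"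
  shows "\<exists>h :: 'a \<Rightarrow> nat. (\<forall>x\<in>W. h x < 2) \<and> (\<forall>x\<in>W. \<forall>y\<in>W. R x y \<longrightarrow> h x \<noteq> h y)"
  using assms(1) acyc
proof (induction W rule: finite_psubset_induct)
  case (psubset W)
  show ?case
  proof (cases "W = {}")
    case False
    have "\<exists>x\<in>W. \<not> (\<exists>y\<in>W. \<exists>z\<in>W. y \<noteq> z \<and> R x y \<and> R x z)"
    proof (rule ccontr)
      assume "\<not> ?thesis"
      then have "\<And>x. x \<in> W \<Longrightarrow> \<exists>y\<in>W. \<exists>z\<in>W. y \<noteq> z \<and> R x y \<and> R x z" by blast
      from min_degree_two_cycle[OF psubset.hyps False sym irrefl this] obtain ys where
        "distinct ys" "set ys \<subseteq> W" "length ys \<ge> 3" "successively R ys" "R (last ys) (hd ys)"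
        by metis
      then show False using psubset.prems by blast
    qed
    then obtain x where x: "x \<in> W" "\<And>y z. y \<in> W \<Longrightarrow> z \<in> W \<Longrightarrow> R x y \<Longrightarrow> R x z \<Longrightarrow> y = z"
      by blast
    have "W - {x} \<subset> W" using x by blast
    then obtain h :: "'a \<Rightarrow> nat" where h: "\<forall>v\<in>W - {x}. h v < 2"
      "\<forall>v\<in>W - {x}. \<forall>y\<in>W - {x}. R v y \<longrightarrow> h v \<noteq> h y"
      using psubset.IH[of "W - {x}"] psubset.prems by blast
    obtain k :: nat where k: "k < 2" "\<And>y. y \<in> W \<Longrightarrow> R x y \<Longrightarrow> h y \<noteq> k"
    proof (cases "\<exists>y\<in>W. R x y \<and> h y = 0")
      case True
      then show ?thesis using that[of 1] x(2) by (metis one_less_numeral_iff semiring_norm(76) zero_neq_one)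
    next
      case False
      then show ?thesis using that[of 0] by auto
    qed
    show ?thesis
    proof (intro exI[of _ "h(x := k)"] conjI ballI impI)
      fix v assume "v \<in> W" then show "(h(x := k)) v < 2" using h k by simp
    next
      fix v y assume *: "v \<in> W" "y \<in> W" "R v y"
      then have "v \<noteq> y" using irrefl by auto
      moreover have "h y \<noteq> k" if "v = x" using * that k by blast
      moreover have "h v \<noteq> k" if "y = x" using * that k sym by blast
      moreover have "h v \<noteq> h y" if "v \<noteq> x" "y \<noteq> x" using * that h by blast
      ultimately show "(h(x := k)) v \<noteq> (h(x := k)) y" by auto
    qed
  qed auto
qed

text \<open>The components of \<open>F\<close> are paths and triangles. An end edge of a path has at
  most two other edges within distance one, so a third color is free for it; if there is no end
  edge, a triangle splits off as a component. The connecting edge \<open>d\<close> may equal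
  \<open>e\<close> or \<open>e'\<close>, so properness is included.\<close>

lemma strong_three_edge_coloring:
  fixes F :: "'a set set"
  assumes "finite F" and two: "\<And>e. e \<in> F \<Longrightarrow> card e = 2"
    and deg: "\<And>v. card {e \<in> F. v \<in> e} \<le> 2"
    and cyc: "\<And>ys. distinct ys \<Longrightarrow> successively (\<lambda>x y. {x, y} \<in> F) ys \<Longrightarrow> ys \<noteq> [] \<Longrightarrow>
      {last ys, hd ys} \<in> F \<Longrightarrow> length ys \<le> 3"
  shows "\<exists>g :: 'a set \<Rightarrow> nat. (\<forall>e\<in>F. g e < 3) \<and>
    (\<forall>e\<in>F. \<forall>e'\<in>F. \<forall>d\<in>F. e \<noteq> e' \<longrightarrow> d \<inter> e \<noteq> {} \<longrightarrow> d \<inter> e' \<noteq> {} \<longrightarrow> g e \<noteq> g e')"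
  using assms
proof (induction F rule: finite_psubset_induct)
  case (psubset F)
  note two = psubset.prems(1) and deg = psubset.prems(2) and cyc = psubset.prems(3)
  have IH: "\<exists>g :: 'a set \<Rightarrow> nat. (\<forall>e\<in>F'. g e < 3) \<and>
    (\<forall>e\<in>F'. \<forall>e'\<in>F'. \<forall>d\<in>F'. e \<noteq> e' \<longrightarrow> d \<inter> e \<noteq> {} \<longrightarrow> d \<inter> e' \<noteq> {} \<longrightarrow> g e \<noteq> g e')"
    if F': "F' \<subset> F" for F'
  proof (rule psubset.IH[OF F'])
    show "card e = 2" if "e \<in> F'" for e using that F' two by blast
    show "card {e \<in> F'. v \<in> e} \<le> 2" for v
      using deg[of v] card_mono[of "{e \<in> F. v \<in> e}" "{e \<in> F'. v \<in> e}"] psubset.hyps F' by fastforce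
    show "length ys \<le> 3" if "distinct ys" "successively (\<lambda>x y. {x, y} \<in> F') ys" "ys \<noteq> []" "{last ys, hd ys} \<in> F'" for ys
    proof (rule cyc)
      show "successively (\<lambda>x y. {x, y} \<in> F) ys"
        using that(2) by (rule successively_mono) (use F' in auto)
    qed (use that F' in auto)
  qed
  have same: "e1 \<in> {e2, e3}" if "e1 \<in> F" "e2 \<in> F" "e3 \<in> F" "v \<in> e1" "v \<in> e2" "v \<in> e3" "e2 \<noteq> e3" for e1 e2 e3 v
  proof (rule ccontr)
    assume "e1 \<notin> {e2, e3}"
    then have "card {e1, e2, e3} = 3" using that by simp
    moreover have "{e1, e2, e3} \<subseteq> {e \<in> F. v \<in> e}" using that by auto
    ultimately show False
      using deg[of v] card_mono[of "{e \<in> F. v \<in> e}" "{e1, e2, e3}"] psubset.hyps by auto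
  qed
  show ?case
  proof (cases "\<exists>v e. e \<in> F \<and> v \<in> e \<and> (\<forall>e'\<in>F. v \<in> e' \<longrightarrow> e' = e)")
    case True
    then obtain x e where e: "e \<in> F" "x \<in> e" and uniq: "\<And>e'. e' \<in> F \<Longrightarrow> x \<in> e' \<Longrightarrow> e' = e" by blast
    obtain y where y: "e = {x, y}" "x \<noteq> y"
      using two[OF e(1)] e(2) by (auto simp: card_2_iff)
    let ?F = "F - {e}"
    have sub: "?F \<subset> F" using e by blast
    obtain g :: "'a set \<Rightarrow> nat" where g: "\<forall>e\<in>?F. g e < 3"
      "\<forall>e\<in>?F. \<forall>e'\<in>?F. \<forall>d\<in>?F. e \<noteq> e' \<longrightarrow> d \<inter> e \<noteq> {} \<longrightarrow> d \<inter> e' \<noteq> {} \<longrightarrow> g e \<noteq> g e'"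
      using IH[OF sub] by (elim exE conjE) (erule (1) that)
    \<comment> \<open>The edges whose colors are forbidden for \<open>e\<close>. If \<open>y\<close>
      has a further edge, they all contain the other end of it; otherwise there are none.\<close>
    define Z where "Z = {e' \<in> ?F. \<exists>d\<in>F. d \<inter> e \<noteq> {} \<and> d \<inter> e' \<noteq> {}}"
    have at_y: "y \<in> e'" if "e' \<in> ?F" "e' \<inter> e \<noteq> {}" for e'
      using that uniq y by blast
    have "\<exists>z. Z \<subseteq> {e' \<in> F. z \<in> e'}"
    proof (cases "\<exists>f\<in>?F. y \<in> f")
      case True
      then obtain f where f: "f \<in> ?F" "y \<in> f" by blast
      obtain z where z: "f = {y, z}"
        using two[of f] f by (auto simp: card_2_iff)
      have f_only: "d = f" if "d \<in> ?F" "y \<in> d" for d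
        using same[of d e f y] that f e y by auto
      have "z \<in> e'" if e': "e' \<in> Z" for e'
      proof -
        obtain d where d: "d \<in> F" "d \<inter> e \<noteq> {}" "d \<inter> e' \<noteq> {}" "e' \<in> ?F"
          using e' by (auto simp: Z_def)
        show ?thesis
        proof (cases "y \<in> e'")
          case True
          then show ?thesis using f_only[of e'] d z by blast
        next
          case False
          then have "d \<noteq> e" using d at_y[OF d(4)] by (metis Int_commute)
          then have "d = f" using d at_y[of d] f_only[of d] by simp
          then show ?thesis using d z False by auto
        qed
      qed
      then show ?thesis by (auto simp: Z_def)
    next
      case False
      have False if e': "e' \<in> Z" for e'
      proof -
        obtain d where d: "d \<in> F" "d \<inter> e \<noteq> {}" "d \<inter> e' \<noteq> {}" "e' \<in> ?F"
          using e' by (auto simp: Z_def)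
        then have "d \<noteq> e" using at_y[OF d(4)] False by (metis Int_commute)
        then show False using d at_y[of d] False by auto
      qed
      then show ?thesis by blast
    qed
    then obtain z where "Z \<subseteq> {e' \<in> F. z \<in> e'}" by blast
    then have "card Z \<le> 2"
      using deg[of z] card_mono[of "{e' \<in> F. z \<in> e'}" Z] psubset.hyps by auto
    moreover have "finite Z"
      using psubset.hyps by (simp add: Z_def)
    ultimately have "card (g ` Z) < card {..<3::nat}"
      using card_image_le[of Z g] by simp
    then obtain k where k: "k < 3" "k \<notin> g ` Z"
      using \<open>finite Z\<close> by (metis card_mono finite_imageI lessThan_iff linorder_not_less subsetI)
    have kZ: "g e' \<noteq> k" if "e' \<in> F" "e' \<noteq> e" "d \<in> F" "d \<inter> e \<noteq> {}" "d \<inter> e' \<noteq> {}" for e' d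
      using k(2) that unfolding Z_def by blast
    show ?thesis
    proof (intro exI[of _ "g(e := k)"] conjI ballI impI)
      fix e' assume "e' \<in> F" then show "(g(e := k)) e' < 3" using g k by simp
    next
      fix e1 e2 d assume *: "e1 \<in> F" "e2 \<in> F" "d \<in> F" "e1 \<noteq> e2" "d \<inter> e1 \<noteq> {}" "d \<inter> e2 \<noteq> {}"
      consider "e1 = e" | "e2 = e" | "e1 \<in> ?F" "e2 \<in> ?F" "d \<in> ?F" | "e1 \<in> ?F" "e2 \<in> ?F" "d = e"
        using * by blast
      then show "(g(e := k)) e1 \<noteq> (g(e := k)) e2"
      proof cases
        case 1
        then show ?thesis using kZ[of e2 d] * by auto
      next
        case 2
        then show ?thesis using kZ[of e1 d] * by auto
      next
        case 3
        then show ?thesis using g(2) * by auto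
      next
        case 4
        \<comment> \<open>Two edges at \<open>y\<close> besides \<open>e\<close> would give
          \<open>y\<close> degree three.\<close>
        then have "y \<in> e1" "y \<in> e2" using at_y[of e1] at_y[of e2] * by blast+
        then have "e1 \<in> {e, e2}" using same[of e1 e e2 y] 4 e y * by auto
        then show ?thesis using 4 * by auto
      qed
    qed
  next
    case False
    show ?thesis
    proof (cases "F = {}")
      case nonempty: False
      have fin: "finite (\<Union>F)"
        using psubset.hyps two by (metis card.infinite finite_Union zero_neq_numeral)
      have ne: "\<Union>F \<noteq> {}"
        using nonempty two by (metis Union_upper all_not_in_conv card.empty subset_empty zero_neq_numeral)
      have nbrs: "\<exists>y\<in>\<Union>F. \<exists>z\<in>\<Union>F. y \<noteq> z \<and> {x, y} \<in> F \<and> {x, z} \<in> F" if x: "x \<in> \<Union>F" for x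
      proof -
        obtain e e' where e: "e \<in> F" "x \<in> e" "e' \<in> F" "x \<in> e'" "e' \<noteq> e"
          using x False by blast
        obtain y z where "e = {x, y}" "e' = {x, z}"
          using two[OF e(1)] two[OF e(3)] e by (auto simp: card_2_iff doubleton_eq_iff)
        then show ?thesis using e by blast
      qed
      have no_loop: "{x, x} \<notin> F" for x
        using two[of "{x, x}"] by auto
      obtain ys where ys: "distinct ys" "set ys \<subseteq> \<Union>F" "length ys \<ge> 3"
        "successively (\<lambda>x y. {x, y} \<in> F) ys" "{last ys, hd ys} \<in> F"
      proof (rule min_degree_two_cycle[OF fin ne, of "\<lambda>x y. {x, y} \<in> F"])
        show "{y, x} \<in> F" if "{x, y} \<in> F" for x y
          using that by (simp add: insert_commute)
      qed (rule no_loop nbrs that; assumption)+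
      then have "length ys = 3"
        using cyc[OF ys(1,4) _ ys(5)] by fastforce
      then obtain a b c where "ys = [a, b, c]"
        by (auto simp: numeral_3_eq_3 length_Suc_conv)
      then have abc: "a \<noteq> b" "b \<noteq> c" "a \<noteq> c" "{a, b} \<in> F" "{b, c} \<in> F" "{c, a} \<in> F"
        using ys by auto
      let ?T = "{{a, b}, {b, c}, {c, a}}"
      let ?F = "F - ?T"
      \<comment> \<open>The vertices of the triangle have degree two within it, so no other edge of
        \<open>F\<close> touches it.\<close>
      have T: "e \<in> ?T" if "e \<in> F" "e \<inter> {a, b, c} \<noteq> {}" for e
        using that same[of e "{a, b}" "{c, a}" a] same[of e "{a, b}" "{b, c}" b] same[of e "{b, c}" "{c, a}" c] abc
        by (auto simp: doubleton_eq_iff)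
      have sub: "?F \<subset> F" using abc by blast
      obtain g :: "'a set \<Rightarrow> nat" where g: "\<forall>e\<in>?F. g e < 3"
        "\<forall>e\<in>?F. \<forall>e'\<in>?F. \<forall>d\<in>?F. e \<noteq> e' \<longrightarrow> d \<inter> e \<noteq> {} \<longrightarrow> d \<inter> e' \<noteq> {} \<longrightarrow> g e \<noteq> g e'"
        using IH[OF sub] by (elim exE conjE) (erule (1) that)
      have ne3: "{a, b} \<noteq> {b, c}" "{a, b} \<noteq> {c, a}" "{b, c} \<noteq> {c, a}"
        using abc by (auto simp: doubleton_eq_iff)
      define g' where "g' = g({a, b} := 0, {b, c} := 1, {c, a} := 2)"
      have g'T: "g' {a, b} = 0" "g' {b, c} = 1" "g' {c, a} = 2"
        using ne3 by (auto simp: g'_def)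
      have g'F: "g' e = g e" if "e \<in> ?F" for e
        using that by (auto simp: g'_def)
      have far: "d \<in> ?F" if "d \<in> F" "e \<in> ?F" "d \<inter> e \<noteq> {}" for d e
        using that T[of e] by blast
      have near: "d \<in> ?T" if "d \<in> F" "e \<in> ?T" "d \<inter> e \<noteq> {}" for d e
        using that T[of d] by blast
      show ?thesis
      proof (intro exI[of _ g'] conjI ballI impI)
        fix e assume "e \<in> F"
        then show "g' e < 3"
          using g(1) g'T g'F[of e] by (cases "e \<in> ?T") auto
      next
        fix e1 e2 d assume *: "e1 \<in> F" "e2 \<in> F" "d \<in> F" "e1 \<noteq> e2" "d \<inter> e1 \<noteq> {}" "d \<inter> e2 \<noteq> {}"
        show "g' e1 \<noteq> g' e2"
        proof (cases "d \<in> ?T")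
          case True
          then have "e1 \<in> ?T" "e2 \<in> ?T"
            using near[OF *(1) True] near[OF *(2) True] *(5,6) by (metis Int_commute)+
          then show ?thesis using *(4) g'T by auto
        next
          case False
          then have "e1 \<in> ?F" "e2 \<in> ?F" "d \<in> ?F"
            using near[of d e1] near[of d e2] * by blast+
          then show ?thesis using g(2) g'F * by metis
        qed
      qed
    qed auto
  qed
qed

section \<open>Star edge coloring of forests\<close>

text \<open>Let \<open>n\<close> colors stand on a circle, each beating the next
  \<open>(n - 1) div 2\<close>. Twice this number is below \<open>n\<close>, so no two colors beat
  each other. \<open>A x\<close> consists of the absent colors and those beaten by \<open>x\<close>.
  The color in position 0 is beaten only from the last \<open>(n - 1) div 2\<close>
  positions.\<close>

lemma cyclic_color_supply:
  fixes xs :: "nat list"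
  assumes xs: "distinct xs" "set xs \<subseteq> {..<D + D div 2}" "length xs \<le> D"
  obtains A where
    "\<And>x. x \<in> set xs \<Longrightarrow> A x \<subseteq> {..<D + D div 2} \<and> {..<D + D div 2} - set xs \<subseteq> A x \<and> D \<le> card (A x) + 1 \<and> x \<notin> A x"
    "\<And>x y. x \<in> set xs \<Longrightarrow> y \<in> set xs \<Longrightarrow> y \<in> A x \<Longrightarrow> x \<notin> A y"
    "\<And>i. 1 \<le> i \<Longrightarrow> i + (length xs - 1) div 2 < length xs \<Longrightarrow> xs ! 0 \<notin> A (xs ! i)"
proof -
  define n where "n = length xs"
  define h where "h = (n - 1) div 2"
  let ?K = "D + D div 2"
  define beats where "beats i = (\<lambda>d. (i + d) mod n) ` {1..h}" for i
  define idx where "idx x = (THE i. i < n \<and> xs ! i = x)" for x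
  define A where "A x = ({..<?K} - set xs) \<union> (\<lambda>j. xs ! j) ` beats (idx x)" for x
  have idx: "idx (xs ! i) = i" if "i < n" for i
    unfolding idx_def using that xs by (auto simp: n_def nth_eq_iff_index_eq)
  have beats_lt: "j < n" if "j \<in> beats i" "i < n" for i j
    using that by (auto simp: beats_def)
  have h_less: "h < n" if "i < n" for i
    using that by (auto simp: h_def)
  have wrap: "(i + d) mod n = (if i + d < n then i + d else i + d - n)" if "i < n" "d \<le> h" for i d
    using that h_less[of i] by (simp add: mod_if)
  have beats_iff: "j \<in> beats i \<longleftrightarrow> (i < j \<and> j \<le> i + h) \<or> (j < i \<and> j + n \<le> i + h)" if "i < n" "j < n" for i j
  proof
    assume "j \<in> beats i"
    then obtain d where d: "1 \<le> d" "d \<le> h" "j = (i + d) mod n"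
      by (auto simp: beats_def)
    then show "(i < j \<and> j \<le> i + h) \<or> (j < i \<and> j + n \<le> i + h)"
      using wrap[of i d] that h_less[of i] by (auto split: if_splits)
  next
    assume "(i < j \<and> j \<le> i + h) \<or> (j < i \<and> j + n \<le> i + h)"
    then show "j \<in> beats i"
    proof
      assume "i < j \<and> j \<le> i + h"
      then have "j = (i + (j - i)) mod n" "j - i \<in> {1..h}" using that by auto
      then show ?thesis unfolding beats_def by blast
    next
      assume *: "j < i \<and> j + n \<le> i + h"
      have "(i + (j + n - i)) mod n = (j + n) mod n" using * that by simp
      then have "j = (i + (j + n - i)) mod n" "j + n - i \<in> {1..h}" using * that by auto
      then show ?thesis unfolding beats_def by blast
    qed
  qed
  have card_beats: "card (beats i) = h" if "i < n" for i
  proof -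
    have "inj_on (\<lambda>d. (i + d) mod n) {1..h}"
      using wrap that h_less[of i] by (auto simp: inj_on_def split: if_splits)
    then show ?thesis unfolding beats_def by (simp add: card_image)
  qed
  have in_A: "xs ! j \<in> A (xs ! i) \<longleftrightarrow> j \<in> beats i" if "i < n" "j < n" for i j
    using that xs beats_lt[of _ i] unfolding A_def by (auto simp: idx n_def nth_eq_iff_index_eq)
  have hh: "2 * h < n" if "n > 0" using that by (auto simp: h_def)
  show thesis
  proof
    fix x assume "x \<in> set xs"
    then obtain i where i: "i < n" "x = xs ! i"
      by (auto simp: in_set_conv_nth n_def)
    have sub: "(\<lambda>j. xs ! j) ` beats i \<subseteq> set xs"
      using beats_lt i by (auto simp: n_def)
    then have "A x \<subseteq> {..<?K}" "{..<?K} - set xs \<subseteq> A x"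
      using xs i by (auto simp: A_def idx)
    moreover have "card (A x) = card ({..<?K} - set xs) + card ((\<lambda>j. xs ! j) ` beats i)"
      unfolding A_def using sub i by (subst card_Un_disjoint) (auto simp: beats_def idx)
    moreover have "card ((\<lambda>j. xs ! j) ` beats i) = h"
      using card_beats[OF i(1)] xs beats_lt i
      by (subst card_image) (auto simp: inj_on_def nth_eq_iff_index_eq n_def)
    moreover have "card ({..<?K} - set xs) = ?K - n"
      using xs by (simp add: card_Diff_subset distinct_card n_def)
    \<comment> \<open>Tight for \<open>n = D\<close>, where
      \<open>D div 2 + (D - 1) div 2 = D - 1\<close>. One less than \<open>D\<close> is enough
      because a vertex with a parent has at most \<open>D - 1\<close> children.\<close>
    moreover have "D \<le> ?K - n + h + 1"
      using xs(3) i unfolding n_def[symmetric] h_def by linarith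
    moreover have "x \<notin> A x"
      using in_A[of i i] i beats_iff[of i i] hh by auto
    ultimately show "A x \<subseteq> {..<?K} \<and> {..<?K} - set xs \<subseteq> A x \<and> D \<le> card (A x) + 1 \<and> x \<notin> A x"
      by auto
  next
    fix x y assume "x \<in> set xs" "y \<in> set xs" and yx: "y \<in> A x"
    then obtain i j where i: "i < n" "x = xs ! i" and j: "j < n" "y = xs ! j"
      by (auto simp: in_set_conv_nth n_def)
    then show "x \<notin> A y"
      using yx in_A[of i j] in_A[of j i] beats_iff[of i j] beats_iff[of j i] hh by auto
  next
    fix i assume i: "1 \<le> i" "i + (length xs - 1) div 2 < length xs"
    then have "i < n" "0 < n" by (auto simp: n_def)
    then show "xs ! 0 \<notin> A (xs ! i)"
      using in_A[of i 0] beats_iff[of i 0] i by (auto simp: h_def n_def)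
  qed
qed

text \<open>In the application \<open>Q\<close> holds the colors of the edges from a vertex to its
  children, \<open>a\<close> is the color of the edge to its parent, \<open>N\<close> holds all
  colors at the vertex and \<open>P\<close> those at its parent. Starting the circle with
  \<open>a\<close> and then \<open>Q \<inter> P\<close> puts the latter into positions that do not
  beat \<open>a\<close>; here the bound on \<open>Q \<inter> P\<close> enters.\<close>

lemma color_supply:
  fixes Q :: "nat set"
  assumes Q: "finite Q" "a \<notin> Q" "N = Q \<or> N = insert a Q" "a \<in> N \<or> P = {}"
    and N: "N \<subseteq> {..<D + D div 2}" "card N \<le> D"
    and P: "card (Q \<inter> P) \<le> (card Q + 1) div 2"
  shows "\<exists>A. \<forall>x\<in>Q. A x \<subseteq> {..<D + D div 2} \<and> {..<D + D div 2} - N \<subseteq> A x \<and> D \<le> card (A x) + 1 \<and>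
    x \<notin> A x \<and> (a \<in> A x \<longrightarrow> x \<notin> P) \<and> (\<forall>y\<in>Q. y \<in> A x \<longrightarrow> x \<notin> A y)"
proof -
  let ?ys = "sorted_list_of_set (Q \<inter> P)" and ?zs = "sorted_list_of_set (Q - P)"
  define xs where "xs = (if a \<in> N then [a] else []) @ ?ys @ ?zs"
  have set_xs: "set xs = N"
    using Q by (auto simp: xs_def)
  have dist: "distinct xs"
    using Q by (auto simp: xs_def)
  obtain A where A: "\<And>x. x \<in> set xs \<Longrightarrow> A x \<subseteq> {..<D + D div 2} \<and> {..<D + D div 2} - set xs \<subseteq> A x \<and> D \<le> card (A x) + 1 \<and> x \<notin> A x"
    "\<And>x y. x \<in> set xs \<Longrightarrow> y \<in> set xs \<Longrightarrow> y \<in> A x \<Longrightarrow> x \<notin> A y"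
    "\<And>i. 1 \<le> i \<Longrightarrow> i + (length xs - 1) div 2 < length xs \<Longrightarrow> xs ! 0 \<notin> A (xs ! i)"
    using cyclic_color_supply[of xs D] dist set_xs N distinct_card[OF dist] by metis
  have aP: "a \<notin> A x" if x: "x \<in> Q" "x \<in> P" for x
  proof -
    have aN: "a \<in> N" using Q(4) x by blast
    have len: "length xs = card Q + 1"
      using distinct_card[OF dist] set_xs aN Q by auto
    have "x \<in> set ?ys" using x Q by simp
    then obtain j where j: "j < card (Q \<inter> P)" "?ys ! j = x"
      by (auto simp: in_set_conv_nth)
    then have "xs ! Suc j = x" "xs ! 0 = a"
      using aN by (simp_all add: xs_def nth_append)
    \<comment> \<open>Here \<open>(length xs - 1) div 2\<close> is half of \<open>card Q\<close>
      rounded down, and \<open>j\<close> is less than that half rounded up; the two halves add up to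
      \<open>card Q\<close>.\<close>
    moreover have "Suc j + (length xs - 1) div 2 < length xs"
      using j P len by simp
    ultimately show ?thesis using A(3)[of "Suc j"] by simp
  qed
  have "Q \<subseteq> set xs" using set_xs Q by auto
  then show ?thesis
    using A(1,2) aP set_xs by (intro exI[of _ A]) blast
qed

text \<open>Take \<open>m div 2\<close> elements outside \<open>N\<close> first and fill up
  arbitrarily; only the filling, half of \<open>m\<close> rounded up, can meet
  \<open>N\<close>.\<close>

lemma subset_avoiding_half:
  assumes "finite A" "m \<le> card A" "m div 2 \<le> card (A - N)"
  shows "\<exists>S\<subseteq>A. card S = m \<and> card (S \<inter> N) \<le> (m + 1) div 2"
proof -
  obtain S1 where S1: "S1 \<subseteq> A - N" "card S1 = m div 2" "finite S1"
    using obtain_subset_with_card_n[OF assms(3)] by metis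
  have "m - m div 2 \<le> card (A - S1)"
    using S1 assms by (subst card_Diff_subset) auto
  then obtain S2 where S2: "S2 \<subseteq> A - S1" "card S2 = m - m div 2" "finite S2"
    using obtain_subset_with_card_n by metis
  have "card (S1 \<union> S2) = m"
    using S1 S2 by (subst card_Un_disjoint) auto
  moreover have "card ((S1 \<union> S2) \<inter> N) \<le> card S2"
    using S1 S2 by (intro card_mono) auto
  ultimately show ?thesis
    using S1 S2 by (intro exI[of _ "S1 \<union> S2"]) auto
qed

section \<open>Top-down coloring of a layered forest\<close>

text \<open>The roots are the vertices of level 0, where the value of \<open>par\<close> has no
  meaning. \<open>D\<close> bounds the degree in the forest, with the edge to the parent counted off
  the roots.\<close>

locale layered_forest =
  fixes V :: "'a set" and lev :: "'a \<Rightarrow> nat" and par :: "'a \<Rightarrow> 'a" and D :: nat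
  assumes fin: "finite V"
    and par_in: "\<And>v. v \<in> V \<Longrightarrow> lev v > 0 \<Longrightarrow> par v \<in> V"
    and lev_par: "\<And>v. v \<in> V \<Longrightarrow> lev v > 0 \<Longrightarrow> lev v = Suc (lev (par v))"
    and degree_bound: "\<And>q. q \<in> V \<Longrightarrow> card {v \<in> V. lev v > 0 \<and> par v = q} + (if lev q > 0 then 1 else 0) \<le> D"
begin

definition children :: "'a \<Rightarrow> 'a set" where
  "children q = {v \<in> V. lev v > 0 \<and> par v = q}"

text \<open>The color of the edge between \<open>v\<close> and its parent is \<open>c v\<close>.\<close>

definition colors_at :: "('a \<Rightarrow> nat) \<Rightarrow> 'a \<Rightarrow> nat set" where
  "colors_at c q = c ` children q \<union> (if lev q > 0 then {c q} else {})"

text \<open>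
  The last conjunct keeps the top-down construction going: the color of the edge above \<open>q\<close> can be
  reused below about half of the children of \<open>q\<close>, but only below those whose color is absent at \<open>par q\<close>.
\<close>

definition good_at :: "('a \<Rightarrow> nat) \<Rightarrow> 'a \<Rightarrow> bool" where
  "good_at c q \<longleftrightarrow> inj_on c (children q) \<and> c ` children q \<subseteq> {..<D + D div 2} \<and>
     (lev q > 0 \<longrightarrow> c q \<notin> c ` children q \<and>
        (\<forall>q'\<in>children (par q). q' \<noteq> q \<longrightarrow> \<not> (c q' \<in> c ` children q \<and> c q \<in> c ` children q')) \<and>
        (lev (par q) > 0 \<longrightarrow> c (par q) \<in> c ` children q \<longrightarrow> c q \<notin> colors_at c (par (par q))) \<and>
        card (c ` children q \<inter> colors_at c (par q)) \<le> (card (children q) + 1) div 2)"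

lemma childrenD: "v \<in> children q \<Longrightarrow> v \<in> V \<and> lev v = Suc (lev q) \<and> par v = q"
  using lev_par by (auto simp: children_def)

lemma in_children_par: "v \<in> V \<Longrightarrow> lev v > 0 \<Longrightarrow> v \<in> children (par v)"
  by (simp add: children_def)

lemma finite_children: "finite (children q)"
  using fin by (simp add: children_def)

lemma card_children: "q \<in> V \<Longrightarrow> card (children q) + (if lev q > 0 then 1 else 0) \<le> D"
  using degree_bound[of q] by (simp add: children_def)

lemma image_children_cong:
  "(\<And>v. v \<in> children q \<Longrightarrow> c' v = c v) \<Longrightarrow> c' ` children q = c ` children q"
  by (rule image_cong) auto

lemma colors_at_cong:
  assumes "\<And>v. v \<in> V \<Longrightarrow> lev v \<le> Suc (lev q) \<Longrightarrow> c' v = c v" "q \<in> V"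
  shows "colors_at c' q = colors_at c q"
proof -
  have "c' ` children q = c ` children q"
    by (rule image_children_cong) (use assms(1) childrenD in auto)
  then show ?thesis
    using assms by (simp add: colors_at_def)
qed

text \<open>Goodness at \<open>q\<close> refers only to colors up to the layer of its children, so
  coloring later layers cannot spoil it.\<close>

lemma good_at_cong:
  assumes eq: "\<And>v. v \<in> V \<Longrightarrow> lev v \<le> Suc (lev q) \<Longrightarrow> c' v = c v" and q: "q \<in> V"
  shows "good_at c' q = good_at c q"
proof -
  have im: "c' ` children r = c ` children r" if "lev r \<le> lev q" for r
    by (rule image_children_cong) (use eq childrenD that in auto)
  have inj: "inj_on c' (children q) = inj_on c (children q)"
    by (rule inj_on_cong) (use eq childrenD in auto)
  show ?thesis
  proof (cases "lev q > 0")
    case False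
    then show ?thesis
      unfolding good_at_def using inj im[of q] by simp
  next
    case True
    have p: "par q \<in> V" "lev q = Suc (lev (par q))"
      using par_in lev_par q True by auto
    have "(\<forall>q'\<in>children (par q). q' \<noteq> q \<longrightarrow> \<not> (c' q' \<in> c' ` children q \<and> c' q \<in> c' ` children q'))
      \<longleftrightarrow> (\<forall>q'\<in>children (par q). q' \<noteq> q \<longrightarrow> \<not> (c q' \<in> c ` children q \<and> c q \<in> c ` children q'))"
    proof (rule ball_cong[OF refl])
      fix q' assume "q' \<in> children (par q)"
      then have "q' \<in> V" "lev q' = lev q"
        using childrenD p by auto
      then show "(q' \<noteq> q \<longrightarrow> \<not> (c' q' \<in> c' ` children q \<and> c' q \<in> c' ` children q'))
        \<longleftrightarrow> (q' \<noteq> q \<longrightarrow> \<not> (c q' \<in> c ` children q \<and> c q \<in> c ` children q'))"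
        using im[of q] im[of q'] eq[of q'] eq[of q] q by simp
    qed
    moreover have "colors_at c' (par q) = colors_at c (par q)"
      by (rule colors_at_cong) (use eq p in auto)
    moreover have "colors_at c' (par (par q)) = colors_at c (par (par q))" if "lev (par q) > 0"
    proof (rule colors_at_cong)
      show "par (par q) \<in> V" using par_in p that by auto
      show "c' v = c v" if "v \<in> V" "lev v \<le> Suc (lev (par (par q)))" for v
        using eq that p lev_par[OF p(1)] \<open>lev (par q) > 0\<close> by auto
    qed
    moreover have "c' q = c q" "c' (par q) = c (par q)"
      using eq q p by auto
    ultimately show ?thesis
      unfolding good_at_def using inj im[of q] by auto
  qed
qed

text \<open>The circular arrangement at \<open>p\<close> decides which colors may be used below each
  child \<open>q\<close>. The sets are indexed by the color \<open>c q\<close>, which determines the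
  child by injectivity.\<close>

lemma children_supply:
  assumes good: "\<And>q. q \<in> V \<Longrightarrow> lev q < n \<Longrightarrow> good_at c q" and p: "p \<in> V" "Suc (lev p) = n"
  shows "\<exists>A. \<forall>q\<in>children p. A (c q) \<subseteq> {..<D + D div 2} \<and>
    {..<D + D div 2} - colors_at c p \<subseteq> A (c q) \<and> D \<le> card (A (c q)) + 1 \<and> c q \<notin> A (c q) \<and>
    (lev p > 0 \<longrightarrow> c p \<in> A (c q) \<longrightarrow> c q \<notin> colors_at c (par p)) \<and>
    (\<forall>q'\<in>children p. c q' \<in> A (c q) \<longrightarrow> c q \<notin> A (c q'))"
proof -
  have gp: "good_at c p"
    using good p by auto
  then have inj: "inj_on c (children p)" and sub: "c ` children p \<subseteq> {..<D + D div 2}"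
    by (auto simp: good_at_def)
  have card_Q: "card (c ` children p) = card (children p)"
    by (rule card_image[OF inj])
  define Q where "Q = c ` children p"
  define P where "P = (if lev p > 0 then colors_at c (par p) else {})"
  \<comment> \<open>A root has no edge to a parent; the substitute \<open>D + D div 2\<close> lies
    outside the palette, so it is neither a child's color nor in any supply set.\<close>
  define a where "a = (if lev p > 0 then c p else D + D div 2)"
  have "\<exists>A. \<forall>x\<in>Q. A x \<subseteq> {..<D + D div 2} \<and> {..<D + D div 2} - colors_at c p \<subseteq> A x \<and> D \<le> card (A x) + 1 \<and>
    x \<notin> A x \<and> (a \<in> A x \<longrightarrow> x \<notin> P) \<and> (\<forall>y\<in>Q. y \<in> A x \<longrightarrow> x \<notin> A y)"
  proof (rule color_supply)
    show "finite Q" by (simp add: Q_def finite_children)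
    show "a \<notin> Q" using gp sub by (auto simp: a_def good_at_def Q_def)
    show "colors_at c p = Q \<or> colors_at c p = insert a Q"
      by (simp add: colors_at_def Q_def a_def)
    show "a \<in> colors_at c p \<or> P = {}"
      by (simp add: colors_at_def a_def P_def)
    have "c p < D + D div 2" if "lev p > 0"
    proof -
      have "good_at c (par p)"
        using good par_in[OF p(1) that] lev_par[OF p(1) that] p by simp
      then show ?thesis
        using in_children_par[OF p(1) that] by (auto simp: good_at_def)
    qed
    then show "colors_at c p \<subseteq> {..<D + D div 2}"
      using sub by (auto simp: colors_at_def)
    show "card (colors_at c p) \<le> D"
      using card_children[OF p(1)] card_Q finite_children[of p] gp
      by (auto simp: colors_at_def good_at_def split: if_splits)
    show "card (Q \<inter> P) \<le> (card Q + 1) div 2"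
      using gp card_Q by (auto simp: P_def Q_def good_at_def)
  qed
  then obtain A where "\<forall>x\<in>Q. A x \<subseteq> {..<D + D div 2} \<and> {..<D + D div 2} - colors_at c p \<subseteq> A x \<and> D \<le> card (A x) + 1 \<and>
    x \<notin> A x \<and> (a \<in> A x \<longrightarrow> x \<notin> P) \<and> (\<forall>y\<in>Q. y \<in> A x \<longrightarrow> x \<notin> A y)" ..
  then show ?thesis
    by (intro exI[of _ A]) (auto simp: Q_def a_def P_def split: if_splits)
qed

text \<open>Goodness at levels less than \<open>n\<close> involves colors of vertices up to level
  \<open>n\<close>; now the children of the vertices of level \<open>n\<close> are colored from the
  supply sets. These sets provide the exclusions between siblings and with the layers above.
  Preferring colors absent at the parent gives the cardinality condition.\<close>

lemma color_next_layer:
  assumes good: "\<And>q. q \<in> V \<Longrightarrow> lev q < n \<Longrightarrow> good_at c q"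
  shows "\<exists>c'. \<forall>q\<in>V. lev q < Suc n \<longrightarrow> good_at c' q"
proof -
  let ?K = "D + D div 2"
  let ?supply = "\<lambda>A p q. A (c q) \<subseteq> {..<?K} \<and>
    {..<?K} - colors_at c p \<subseteq> A (c q) \<and> D \<le> card (A (c q)) + 1 \<and> c q \<notin> A (c q) \<and>
    (lev p > 0 \<longrightarrow> c p \<in> A (c q) \<longrightarrow> c q \<notin> colors_at c (par p)) \<and>
    (\<forall>q'\<in>children p. c q' \<in> A (c q) \<longrightarrow> c q \<notin> A (c q'))"
  have "\<forall>p\<in>{p \<in> V. Suc (lev p) = n}. \<exists>A. \<forall>q\<in>children p. ?supply A p q"
    by (intro ballI children_supply[OF good]) auto
  from bchoice[OF this] obtain A where "\<forall>p\<in>{p \<in> V. Suc (lev p) = n}. \<forall>q\<in>children p. ?supply (A p) p q" ..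
  then have A: "?supply (A p) p q" if "p \<in> V" "Suc (lev p) = n" "q \<in> children p" for p q
    using that by simp
  define B where "B q = (if n > 0 then A (par q) (c q) else {..<?K})" for q
  have "\<exists>F. \<forall>q\<in>V. lev q = n \<longrightarrow> inj_on (F q) (children q) \<and> F q ` children q \<subseteq> B q \<and>
    (n > 0 \<longrightarrow> card (F q ` children q \<inter> colors_at c (par q)) \<le> (card (children q) + 1) div 2)"
  proof (rule bchoice, intro ballI)
    fix q assume q: "q \<in> V"
    let ?m = "card (children q)"
    have choose: "\<exists>f. inj_on f (children q) \<and> f ` children q = S" if "finite S" "card S = ?m" for S :: "nat set"
      using finite_same_card_bij[OF finite_children that(1)] that(2) by (metis bij_betw_def)
    show "\<exists>f. lev q = n \<longrightarrow> inj_on f (children q) \<and> f ` children q \<subseteq> B q \<and>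
      (n > 0 \<longrightarrow> card (f ` children q \<inter> colors_at c (par q)) \<le> (card (children q) + 1) div 2)"
    proof (cases "lev q = n")
      case lev: True
      have m: "?m + (if n > 0 then 1 else 0) \<le> D"
        using card_children[OF q] lev by simp
      show ?thesis
      proof (cases "n > 0")
        case False
        have "?m \<le> card {..<?K}" using m by simp
        then obtain S where "S \<subseteq> {..<?K}" "card S = ?m" "finite S"
          by (metis obtain_subset_with_card_n)
        then show ?thesis
          using choose[of S] False by (auto simp: B_def)
      next
        case True
        define p where "p = par q"
        have p: "p \<in> V" "Suc (lev p) = n" "q \<in> children p"
          using par_in lev_par[OF q] in_children_par[OF q] q lev True by (auto simp: p_def)
        have Bq: "B q = A p (c q)" using True by (simp add: B_def p_def)
        have "finite (B q)"
          using A[OF p] unfolding Bq by (meson finite_lessThan finite_subset)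
        moreover have "?m \<le> card (B q)"
          using A[OF p] m True unfolding Bq by auto
        \<comment> \<open>At most \<open>D\<close> colors occur at \<open>p\<close>, so at least
          \<open>D div 2\<close> of the palette are absent there, and the supply set contains all of
          these.\<close>
        moreover have "?m div 2 \<le> card (B q - colors_at c p)"
        proof -
          have fin_at: "finite (colors_at c p)"
            by (simp add: colors_at_def finite_children)
          have "card (colors_at c p) \<le> card (c ` children p) + (if lev p > 0 then 1 else 0)"
            unfolding colors_at_def by (auto intro: order_trans[OF card_insert_le_m1] simp: card_insert_if finite_children)
          also have "\<dots> \<le> card (children p) + (if lev p > 0 then 1 else 0)"
            by (simp add: card_image_le finite_children)
          also have "\<dots> \<le> D"
            by (rule card_children[OF p(1)])
          finally have "D div 2 \<le> card ({..<?K} - colors_at c p)"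
            using diff_card_le_card_Diff[OF fin_at, of "{..<?K}"] by simp
          also have "\<dots> \<le> card (B q - colors_at c p)"
            using A[OF p] \<open>finite (B q)\<close> unfolding Bq by (intro card_mono) auto
          finally show ?thesis using m by (meson div_le_mono le_trans le_add1)
        qed
        ultimately obtain S where S: "S \<subseteq> B q" "card S = ?m" "card (S \<inter> colors_at c p) \<le> (?m + 1) div 2"
          using subset_avoiding_half by blast
        moreover have "finite S" using S \<open>finite (B q)\<close> finite_subset by blast
        ultimately show ?thesis
          using choose[of S] by (auto simp: p_def)
      qed
    qed auto
  qed
  then obtain F where F: "\<And>q. q \<in> V \<Longrightarrow> lev q = n \<Longrightarrow> inj_on (F q) (children q)"
    "\<And>q. q \<in> V \<Longrightarrow> lev q = n \<Longrightarrow> F q ` children q \<subseteq> B q"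
    "\<And>q. q \<in> V \<Longrightarrow> lev q = n \<Longrightarrow> n > 0 \<Longrightarrow> card (F q ` children q \<inter> colors_at c (par q)) \<le> (card (children q) + 1) div 2"
    by metis
  define c' where "c' v = (if lev v = Suc n then F (par v) v else c v)" for v
  have old: "c' v = c v" if "lev v \<le> n" for v
    using that by (simp add: c'_def)
  have new: "c' v = F q v" if "v \<in> children q" "lev q = n" for q v
    using childrenD[OF that(1)] that(2) by (simp add: c'_def)
  have new_im: "c' ` children q = F q ` children q" if "lev q = n" for q
    by (rule image_cong) (use new that in auto)
  have "good_at c' q" if q: "q \<in> V" "lev q < Suc n" for q
  proof (cases "lev q < n")
    case True
    then have "good_at c' q = good_at c q"
      using old q by (intro good_at_cong) auto
    then show ?thesis using good q True by simp
  next
    case False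
    then have lev: "lev q = n" using q by simp
    have inj: "inj_on c' (children q)"
      using F(1)[OF q(1) lev] new[OF _ lev] by (auto simp: inj_on_def)
    have FB: "c' ` children q \<subseteq> B q"
      using F(2)[OF q(1) lev] new_im[OF lev] by simp
    show ?thesis
    proof (cases "n > 0")
      case False
      then show ?thesis
        unfolding good_at_def using inj FB lev by (simp add: B_def)
    next
      case True
      define p where "p = par q"
      have p: "p \<in> V" "Suc (lev p) = n" "q \<in> children p"
        using par_in lev_par[OF q(1)] in_children_par[OF q(1)] q lev True by (auto simp: p_def)
      have Bq: "B r = A p (c r)" if "r \<in> children p" for r
        using True childrenD[OF that] by (simp add: B_def)
      have sib: "r \<in> V" "lev r = n" if "r \<in> children p" for r
        using childrenD[OF that] p by auto
      have c_old: "c' r = c r" if "r \<in> children p" for r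
        using old sib[OF that] by simp
      have "colors_at c' p = colors_at c p"
        using old p by (intro colors_at_cong) auto
      moreover have "colors_at c' (par p) = colors_at c (par p)" if "lev p > 0"
        using old p par_in lev_par[OF p(1)] that by (intro colors_at_cong) auto
      moreover have "c' p = c p" using old p by simp
      moreover have "\<not> (c' q' \<in> c' ` children q \<and> c' q \<in> c' ` children q')"
        if "q' \<in> children p" "q' \<noteq> q" for q'
      proof
        assume "c' q' \<in> c' ` children q \<and> c' q \<in> c' ` children q'"
        moreover have "c' ` children q' \<subseteq> B q'"
          using F(2)[of q'] new_im[of q'] sib[OF that(1)] by simp
        ultimately have "c q' \<in> A p (c q)" "c q \<in> A p (c q')"
          using FB Bq[OF p(3)] Bq[OF that(1)] c_old[OF that(1)] c_old[OF p(3)] by auto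
        then show False using A[OF p] that by blast
      qed
      moreover have "card (c' ` children q \<inter> colors_at c p) \<le> (card (children q) + 1) div 2"
        using F(3)[OF q(1) lev True] new_im[OF lev] by (simp add: p_def)
      ultimately show ?thesis
        unfolding good_at_def p_def[symmetric] using inj FB Bq[OF p(3)] A[OF p] c_old[OF p(3)] by auto
    qed
  qed
  then show ?thesis by (intro exI[of _ c']) blast
qed

lemma good_coloring_exists: "\<exists>c. \<forall>q\<in>V. good_at c q"
proof -
  have "\<exists>c. \<forall>q\<in>V. lev q < n \<longrightarrow> good_at c q" for n
  proof (induction n)
    case (Suc n)
    then show ?case using color_next_layer by blast
  qed auto
  from this[of "Suc (Max (lev ` V))"] show ?thesis
    using fin by (metis Max_ge finite_imageI image_eqI le_imp_less_Suc)
qed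

section \<open>Walks in the forest under a good coloring\<close>

definition up :: "'a \<Rightarrow> 'a \<Rightarrow> bool" where
  "up a b \<longleftrightarrow> a \<in> V \<and> lev a > 0 \<and> par a = b"

lemma upD: "up a b \<Longrightarrow> a \<in> children b \<and> a \<in> V \<and> b \<in> V \<and> par a = b \<and> lev a = Suc (lev b)"
  using par_in lev_par by (auto simp: up_def children_def)

definition edge_color :: "('a \<Rightarrow> nat) \<Rightarrow> 'a \<Rightarrow> 'a \<Rightarrow> nat" where
  "edge_color c a b = (if lev a > lev b then c a else c b)"

lemma edge_color_up: "up a b \<Longrightarrow> edge_color c a b = c a" "up a b \<Longrightarrow> edge_color c b a = c a"
  using upD[of a b] by (auto simp: edge_color_def)

lemma colors_at_up: "up a b \<Longrightarrow> c a \<in> colors_at c b \<and> c a \<in> c ` children b"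
  using upD[of a b] by (auto simp: colors_at_def)

text \<open>The color of the edge above \<open>w\<close>, the parent of \<open>v\<close>, reappears
  below \<open>v\<close>. Goodness at \<open>v\<close> then forbids \<open>c v\<close> at
  \<open>x\<close>, but the fourth edge carries it there.\<close>

lemma good_no_bichromatic_up3:
  assumes good: "\<And>q. q \<in> V \<Longrightarrow> good_at c q" and "up u v" "up v w" "up w x"
    and "up x y \<or> up y x" and "y \<noteq> w"
    and eq: "edge_color c u v = edge_color c w x" "edge_color c v w = edge_color c x y"
  shows False
proof -
  have "good_at c v" "lev v > 0" "par v = w" "lev w > 0" "par w = x"
    using good upD assms by auto
  moreover have "c u = c w" using eq(1) assms by (simp add: edge_color_up)
  moreover have "c u \<in> c ` children v" using colors_at_up assms by blast
  moreover have "c v \<in> colors_at c x"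
    using eq(2) assms(3,5) colors_at_up[of y x c] upD[of x y] by (auto simp: edge_color_up colors_at_def)
  ultimately show False
    by (simp add: good_at_def)
qed

text \<open>Parents are unique, so a walk without immediate return never goes up after a step down.
  It climbs its first three edges, or descends its last three, or has its peak in the middle; in
  that case \<open>v\<close> and \<open>x\<close> are siblings that use each other's color below.
  \<open>u = y\<close> is allowed.\<close>

lemma good_no_bichromatic:
  assumes good: "\<And>q. q \<in> V \<Longrightarrow> good_at c q"
    and adj: "up u v \<or> up v u" "up v w \<or> up w v" "up w x \<or> up x w" "up x y \<or> up y x"
    and dist: "u \<noteq> w" "v \<noteq> x" "w \<noteq> y"
    and eq: "edge_color c u v = edge_color c w x" "edge_color c v w = edge_color c x y"
  shows False
proof -
  have one_parent: "b = b'" if "up a b" "up a b'" for a b b'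
    using that by (simp add: up_def)
  have sym: "edge_color c a b = edge_color c b a" if "up a b \<or> up b a" for a b
    using that by (auto simp: edge_color_up)
  consider "up u v" "up v w" "up w x" | "up y x" "up x w" "up w v" | "up u v" "up v w" "up x w" "up y x"
    using adj one_parent dist by metis
  then show False
  proof cases
    case 1
    then show False using good_no_bichromatic_up3[OF good 1 adj(4) _ eq] dist by auto
  next
    case 2
    have "edge_color c y x = edge_color c w v" "edge_color c x w = edge_color c v u"
      using eq sym adj by metis+
    then show False using good_no_bichromatic_up3[OF good 2, of u] adj dist by blast
  next
    case 3
    have "c u = c x" "c v = c y"
      using eq 3 by (simp_all add: edge_color_up)
    moreover have "c u \<in> c ` children v" "c y \<in> c ` children x"
      using 3 colors_at_up by blast+
    moreover have "x \<in> children (par v)" "lev v > 0" "good_at c v"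
      using 3 upD good by auto
    ultimately show False
      using dist by (auto simp: good_at_def)
  qed
qed

lemma good_proper:
  assumes good: "\<And>q. q \<in> V \<Longrightarrow> good_at c q"
    and adj: "up u v \<or> up v u" "up v w \<or> up w v" and "u \<noteq> w"
  shows "edge_color c u v \<noteq> edge_color c v w"
proof -
  have gv: "good_at c v" using upD adj good by blast
  consider "up u v" "up v w" | "up v u" "up w v" | "up u v" "up w v" 
    using adj assms(4) by (auto simp: up_def)
  then show ?thesis
  proof cases
    case 1
    then have "c v \<notin> c ` children v" using gv upD[of v w] by (simp add: good_at_def)
    then show ?thesis using 1 colors_at_up[of u v c] by (auto simp: edge_color_up)
  next
    case 2
    then have "c v \<notin> c ` children v" using gv upD[of v u] by (simp add: good_at_def)
    then show ?thesis using 2 colors_at_up[of w v c] by (auto simp: edge_color_up)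
  next
    case 3
    then show ?thesis
      using gv upD[of u v] upD[of w v] assms(4) by (auto simp: edge_color_up good_at_def inj_on_def)
  qed
qed

lemma good_edge_color_less:
  assumes "\<And>q. q \<in> V \<Longrightarrow> good_at c q" "up u v \<or> up v u"
  shows "edge_color c u v < D + D div 2"
proof -
  have "c a < D + D div 2" if "up a b" for a b
    using assms(1)[of b] upD[OF that] by (auto simp: good_at_def)
  then show ?thesis using assms(2) by (auto simp: edge_color_up)
qed

end

section \<open>Combining the colorings\<close>

context K23_free_graph
begin

section \<open>The spanning forest and the second parents\<close>

definition parent :: "'a \<Rightarrow> 'a" where
  "parent v = (SOME u. u \<in> parents v)"

lemma parent_in: "lev v > 0 \<Longrightarrow> parent v \<in> parents v"
  unfolding parent_def using parents_nonempty by (rule someI_ex)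

lemma finite_V: "finite V" and finite_E: "finite E"
proof -
  show "finite V" using simple by (simp add: simple_graph_def)
  moreover have "E \<subseteq> Pow V" using simple by (auto simp: simple_graph_def)
  ultimately show "finite E" using finite_subset by blast
qed

text \<open>Distinct forest neighbors of \<open>q\<close> give distinct edges at \<open>q\<close>,
  and no child is also the parent because the levels differ.\<close>

lemma parent_children_bound:
  assumes "degree E q \<le> D"
  shows "card {v \<in> V. lev v > 0 \<and> parent v = q} + (if lev q > 0 then 1 else 0) \<le> D"
proof -
  let ?C = "{v \<in> V. lev v > 0 \<and> parent v = q}" and ?P = "if lev q > 0 then {parent q} else {}"
  have C: "{v, q} \<in> E \<and> lev v = Suc (lev q)" if "v \<in> ?C" for v
    using that parent_in[of v] parentsD[of q v] edge_sym by auto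
  have P: "{v, q} \<in> E \<and> lev q = Suc (lev v)" if "v \<in> ?P" for v
    using that parent_in[of q] parentsD[of v q] by (auto split: if_splits)
  have "card ?C + card ?P = card (?C \<union> ?P)"
  proof (rule card_Un_disjoint[symmetric])
    have False if "v \<in> ?C" "v \<in> ?P" for v
      using C[OF that(1)] P[OF that(2)] by simp
    then show "?C \<inter> ?P = {}" by blast
  qed (simp_all add: finite_V)
  also have "\<dots> = card ((\<lambda>v. {v, q}) ` (?C \<union> ?P))"
    by (intro card_image[symmetric]) (auto simp: inj_on_def doubleton_eq_iff)
  also have "\<dots> \<le> degree E q"
    unfolding degree_def using finite_E C P by (intro card_mono) (auto simp del: if_split)
  finally show ?thesis using assms by (simp split: if_splits)
qed

lemma level_edges_coloring:
  "\<exists>g :: 'a set \<Rightarrow> nat. (\<forall>e\<in>level_edges. g e < 3) \<and>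
    (\<forall>e\<in>level_edges. \<forall>e'\<in>level_edges. \<forall>d\<in>level_edges.
       e \<noteq> e' \<longrightarrow> d \<inter> e \<noteq> {} \<longrightarrow> d \<inter> e' \<noteq> {} \<longrightarrow> g e \<noteq> g e')"
proof (rule strong_three_edge_coloring)
  show "finite level_edges" using finite_E by (simp add: level_edges_def)
  show "card e = 2" if "e \<in> level_edges" for e
    using that simple by (auto simp: level_edges_def simple_graph_def)
  show "card {e \<in> level_edges. v \<in> e} \<le> 2" for v
  proof -
    let ?N = "{u. {u, v} \<in> E \<and> lev u = lev v}"
    have "{e \<in> level_edges. v \<in> e} \<subseteq> (\<lambda>u. {u, v}) ` ?N"
    proof
      fix e assume e: "e \<in> {e \<in> level_edges. v \<in> e}"
      then obtain a b where "e = {a, b}" "lev a = lev b" "e \<in> E" "v \<in> e"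
        by (auto simp: level_edges_def)
      then show "e \<in> (\<lambda>u. {u, v}) ` ?N"
        by (auto simp: insert_commute image_iff)
    qed
    moreover have "?N \<subseteq> V" using edge_in by blast
    then have "finite ?N" using finite_V finite_subset by blast
    ultimately have "card {e \<in> level_edges. v \<in> e} \<le> card ?N"
      by (rule surj_card_le[rotated])
    then show ?thesis using card_level_neighbors[of v] by simp
  qed
qed (rule level_cycle_length)

text \<open>A two-parent vertex has only one edge to a second parent, so a color of the vertex
  serves as a color of that edge.\<close>

lemma second_parent_coloring:
  "\<exists>h :: 'a \<Rightarrow> nat. (\<forall>v. h v < 2) \<and>
    (\<forall>v w. two_parents v \<longrightarrow> two_parents w \<longrightarrow> share_parent v w \<longrightarrow> h v \<noteq> h w)"
proof -
  let ?W = "{v \<in> V. two_parents v}"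
  have "\<exists>h :: 'a \<Rightarrow> nat. (\<forall>x\<in>?W. h x < 2) \<and> (\<forall>x\<in>?W. \<forall>y\<in>?W. share_parent x y \<longrightarrow> h x \<noteq> h y)"
  proof (rule acyclic_two_coloring)
    show "share_parent y x" if "share_parent x y" for x y
      using that by (auto simp: share_parent_def)
    show "\<not> share_parent (last ys) (hd ys)"
      if "distinct ys" "set ys \<subseteq> ?W" "3 \<le> length ys" "successively share_parent ys" for ys
      using that by (intro share_parent_acyclic) auto
  qed (use finite_V in \<open>auto simp: share_parent_def\<close>)
  then obtain h :: "'a \<Rightarrow> nat" where h: "\<forall>x\<in>?W. h x < 2" "\<forall>x\<in>?W. \<forall>y\<in>?W. share_parent x y \<longrightarrow> h x \<noteq> h y"
    by blast
  have W: "v \<in> V" if "two_parents v" for v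
    using that parentsD by (auto simp: two_parents_def)
  show ?thesis
    \<comment> \<open>The value 0 off the two-parent vertices makes the bound hold
      everywhere.\<close>
    using h W by (intro exI[of _ "\<lambda>v. if two_parents v then h v else 0"]) auto
qed

definition cross :: "'a \<Rightarrow> 'a \<Rightarrow> bool" where
  "cross a b \<longleftrightarrow> b \<in> parents a \<and> parent a \<noteq> b"

lemma crossD: "cross a b \<Longrightarrow> {a, b} \<in> E \<and> lev a = Suc (lev b) \<and> b \<in> parents a \<and> two_parents a"
proof -
  assume "cross a b"
  then have b: "b \<in> parents a" "parent a \<noteq> b" by (auto simp: cross_def)
  then have "parent a \<in> parents a" using parent_in[of a] parentsD[OF b(1)] by simp
  then show ?thesis using b parentsD[OF b(1)] edge_sym by (auto simp: two_parents_def)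
qed

text \<open>Together with the chosen parent, two second parents would make three.\<close>

lemma cross_unique:
  assumes "cross a b" "cross a b'"
  shows "b = b'"
proof (rule ccontr)
  assume "b \<noteq> b'"
  moreover have p: "b \<in> parents a" "b' \<in> parents a" "parent a \<noteq> b" "parent a \<noteq> b'"
    using assms by (auto simp: cross_def)
  moreover have "parent a \<in> parents a"
    using parent_in[of a] parentsD[OF p(1)] by simp
  ultimately have "card {parent a, b, b'} = 3" "{parent a, b, b'} \<subseteq> parents a"
    by auto
  moreover have "finite (parents a)"
    using finite_subset[OF _ finite_V] parentsD by blast
  ultimately show False
    using card_parents[of a] card_mono[of "parents a" "{parent a, b, b'}"] by simp
qed

lemma layered_forest_parent:
  assumes "\<And>v. v \<in> V \<Longrightarrow> degree E v \<le> D"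
  shows "layered_forest V lev parent D"
proof
  show "finite V" by (rule finite_V)
  show "parent v \<in> V" "lev v = Suc (lev (parent v))" if "v \<in> V" "lev v > 0" for v
    using parentsD[OF parent_in[OF that(2)]] by auto
qed (use parent_children_bound assms in blast)

end

section \<open>The combined edge coloring\<close>

locale colored_K23_free_graph = K23_free_graph +
  fixes D :: nat and c :: "'a \<Rightarrow> nat" and g :: "'a set \<Rightarrow> nat" and h :: "'a \<Rightarrow> nat"
  assumes degree_le: "\<And>v. v \<in> V \<Longrightarrow> degree E v \<le> D"
    and c: "\<And>q. q \<in> V \<Longrightarrow> layered_forest.good_at V lev parent D c q"
    and g_less: "\<And>e. e \<in> level_edges \<Longrightarrow> g e < 3"
    and g: "\<And>e e' d. e \<in> level_edges \<Longrightarrow> e' \<in> level_edges \<Longrightarrow> d \<in> level_edges \<Longrightarrow> e \<noteq> e' \<Longrightarrow>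
      d \<inter> e \<noteq> {} \<Longrightarrow> d \<inter> e' \<noteq> {} \<Longrightarrow> g e \<noteq> g e'"
    and h_less: "\<And>v. h v < 2"
    and h: "\<And>v w. two_parents v \<Longrightarrow> two_parents w \<Longrightarrow> share_parent v w \<Longrightarrow> h v \<noteq> h w"
begin

sublocale layered_forest V lev parent D
  using degree_le by (rule layered_forest_parent)

abbreviation "K \<equiv> D + D div 2"

text \<open>The deeper end of an edge between layers. Within a layer the description is not unique,
  and \<open>color\<close> does not use it there.\<close>

definition top :: "'a set \<Rightarrow> 'a" where
  "top e = (THE v. v \<in> e \<and> lev v = Max (lev ` e))"

text \<open>Three blocks: forest edges below \<open>K\<close>, layer edges in the six colors from
  \<open>K\<close> on, edges to second parents in the six from \<open>K + 6\<close> on. For layer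
  edges parity suffices, as a joining edge changes the level by at most one; the deeper ends of
  joined edges to second parents can be two levels apart, which requires residues modulo 3.\<close>

definition color :: "'a set \<Rightarrow> nat" where
  "color e = (if e \<in> level_edges then K + 3 * (Max (lev ` e) mod 2) + g e
     else if parent (top e) \<in> e then c (top e)
     else K + 6 + 2 * (lev (top e) mod 3) + h (top e))"

lemma top_eq:
  assumes "lev a = Suc (lev b)"
  shows "top {a, b} = a" "{a, b} \<notin> level_edges"
proof -
  show "top {a, b} = a"
    unfolding top_def by (rule the_equality) (use assms in auto)
  show "{a, b} \<notin> level_edges"
    using assms by (simp add: level_edges_iff)
qed

lemma color_up:
  assumes "up a b"
  shows "color {a, b} = c a"
proof -
  have "lev a = Suc (lev b)" "parent a = b" using upD[OF assms] by auto
  then show ?thesis by (simp add: color_def top_eq)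
qed

lemma color_cross:
  assumes "cross a b"
  shows "color {a, b} = K + 6 + 2 * (lev a mod 3) + h a"
proof -
  have lev: "lev a = Suc (lev b)" "parent a \<noteq> b" using crossD[OF assms] assms by (auto simp: cross_def)
  moreover have "parent a \<noteq> a"
    using parentsD[OF parent_in[of a]] lev by auto
  ultimately show ?thesis by (simp add: color_def top_eq)
qed

lemma color_level: "{a, b} \<in> level_edges \<Longrightarrow> color {a, b} = K + 3 * (lev a mod 2) + g {a, b}"
  by (simp add: color_def level_edges_iff)

lemma edge_types:
  assumes "{a, b} \<in> E"
  obtains "{a, b} \<in> level_edges" | "up a b \<or> up b a" | "cross a b \<or> cross b a"
proof -
  have "up v u \<or> cross v u" if "u \<in> parents v" for u v
    using parentsD[OF that] that by (auto simp: up_def cross_def)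
  then show thesis
    using assms that by (metis lev_cases level_edges_iff)
qed

lemma edge_color_eq: "up a b \<or> up b a \<Longrightarrow> color {a, b} = edge_color c a b"
  using color_up[of a b] color_up[of b a] edge_color_up[of a b c] edge_color_up[of b a c]
  by (auto simp: insert_commute)

lemma color_ranges:
  shows "up a b \<or> up b a \<Longrightarrow> color {a, b} < K"
    and "{a, b} \<in> level_edges \<Longrightarrow> K \<le> color {a, b} \<and> color {a, b} < K + 6"
    and "cross a b \<or> cross b a \<Longrightarrow> K + 6 \<le> color {a, b} \<and> color {a, b} < K + 12"
proof -
  show "color {a, b} < K" if "up a b \<or> up b a"
    using good_edge_color_less[OF c that] edge_color_eq[OF that] by simp
  show "K \<le> color {a, b} \<and> color {a, b} < K + 6" if "{a, b} \<in> level_edges"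
  proof -
    have "lev a mod 2 < 2" by simp
    then show ?thesis using color_level[OF that] g_less[OF that] by linarith
  qed
  have "K + 6 \<le> color {a, b} \<and> color {a, b} < K + 12" if "cross a b" for a b
  proof -
    have "lev a mod 3 < 3" by simp
    then show ?thesis using color_cross[OF that] h_less[of a] by linarith
  qed
  note cross = this
  have "{b, a} = {a, b}" by auto
  then show "K + 6 \<le> color {a, b} \<and> color {a, b} < K + 12" if "cross a b \<or> cross b a"
    using that cross[of a b] cross[of b a] by auto
qed

lemma same_color_type:
  assumes "{a, b} \<in> E" "{x, y} \<in> E" "color {a, b} = color {x, y}"
  obtains "{a, b} \<in> level_edges" "{x, y} \<in> level_edges"
  | "up a b \<or> up b a" "up x y \<or> up y x"
  | "cross a b \<or> cross b a" "cross x y \<or> cross y x"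
proof -
  note r = color_ranges[of a b] color_ranges[of x y] assms(3)
  show thesis
  proof (rule edge_types[OF assms(1)])
    assume t: "{a, b} \<in> level_edges"
    show thesis
      by (rule edge_types[OF assms(2)]) (use t r that(1) in linarith)+
  next
    assume t: "up a b \<or> up b a"
    show thesis
      by (rule edge_types[OF assms(2)]) (use t r that(2) in linarith)+
  next
    assume t: "cross a b \<or> cross b a"
    show thesis
      by (rule edge_types[OF assms(2)]) (use t r that(3) in linarith)+
  qed
qed

text \<open>Equal colors mean levels of equal parity, and levels at most one apart are then equal.
  So a joining edge lies in the same layer, where \<open>g\<close> separates the two edges.\<close>

lemma level_edges_joined:
  assumes ab: "{a, b} \<in> level_edges" and xy: "{x, y} \<in> level_edges" and ne: "{a, b} \<noteq> {x, y}" and bx: "{b, x} \<in> E \<or> b = x"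
  shows "color {a, b} \<noteq> color {x, y}"
proof
  assume eq: "color {a, b} = color {x, y}"
  have lev: "lev a = lev b" "lev x = lev y"
    using ab xy by (auto simp: level_edges_iff)
  have sum_eq: "3 * (lev a mod 2) + g {a, b} = 3 * (lev x mod 2) + g {x, y}"
    using eq color_level[OF ab] color_level[OF xy] by simp
  then have mod_eq: "lev a mod 2 = lev x mod 2"
    using g_less[OF ab] g_less[OF xy] by linarith
  with sum_eq have g_eq: "g {a, b} = g {x, y}" by simp
  have "lev b = lev x"
    using bx
  proof
    assume "{b, x} \<in> E"
    then have "lev x \<le> Suc (lev b)" "lev b \<le> Suc (lev x)"
      using lev_edge edge_sym by blast+
    moreover have "lev b mod 2 = lev x mod 2" using mod_eq lev by simp
    ultimately show ?thesis by presburger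
  qed simp
  then have "{a, b} \<in> level_edges \<and> b = x \<or> {b, x} \<in> level_edges"
    using bx ab by (auto simp: level_edges_iff)
  then show False
  proof
    assume "{a, b} \<in> level_edges \<and> b = x"
    then show False using g[OF ab xy ab ne] g_eq by auto
  next
    assume "{b, x} \<in> level_edges"
    then show False using g[OF ab xy _ ne, of "{b, x}"] g_eq by auto
  qed
qed

lemma cross_color_eqD:
  assumes "cross a b" "cross x y" "color {a, b} = color {x, y}"
  shows "lev a mod 3 = lev x mod 3" "h a = h x"
proof -
  have "2 * (lev a mod 3) + h a = 2 * (lev x mod 3) + h x"
    using assms color_cross by simp
  moreover from this show "lev a mod 3 = lev x mod 3"
    using h_less[of a] h_less[of x] by linarith
  ultimately show "h a = h x" by simp
qed

text \<open>Different edges to second parents start at different vertices, and \<open>h\<close>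
  separates these if they share a parent.\<close>

lemma cross_common_parent:
  assumes ab: "cross a b" and xy: "cross x y" and ne: "{a, b} \<noteq> {x, y}"
    and u: "u \<in> parents a" "u \<in> parents x"
  shows "color {a, b} \<noteq> color {x, y}"
proof
  assume "color {a, b} = color {x, y}"
  then have "h a = h x" using cross_color_eqD ab xy by blast
  moreover have "a \<noteq> x" using ab xy ne cross_unique by blast
  then have "share_parent a x" using u by (auto simp: share_parent_def)
  ultimately show False using h crossD[OF ab] crossD[OF xy] by blast
qed

text \<open>The levels of the deeper ends differ by at most two, so equal residues modulo 3 make
  them equal. The deeper ends then share a parent, or they are the same vertex and the edges
  coincide. A joining edge is assumed to run between layers.\<close>

lemma cross_edges_joined:
  assumes ab: "cross a b \<or> cross b a" and xy: "cross x y \<or> cross y x" and ne: "{a, b} \<noteq> {x, y}"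
    and bx: "b \<in> parents x \<or> x \<in> parents b \<or> b = x"
  shows "color {a, b} \<noteq> color {x, y}"
proof
  assume eq: "color {a, b} = color {x, y}"
  have sym: "{b, a} = {a, b}" "{y, x} = {x, y}" by auto
  have mod3: "Suc n mod 3 \<noteq> n mod 3" "Suc (Suc n) mod 3 \<noteq> n mod 3" for n :: nat
    by presburger+
  have lev_bx: "lev x = Suc (lev b) \<or> lev b = Suc (lev x) \<or> b = x \<and> lev b = lev x"
    using bx parentsD by blast
  consider (1) "cross a b" "cross x y" | (2) "cross a b" "cross y x" | (3) "cross b a" "cross x y" | (4) "cross b a" "cross y x"
    using ab xy by blast
  then show False
  proof cases
    case 1
    have "lev a mod 3 = lev x mod 3" using cross_color_eqD[OF 1 eq] by simp
    moreover have "lev a = Suc (lev b)" using crossD[OF 1(1)] by simp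
    ultimately have "lev x = Suc (lev b)" using lev_bx mod3 by metis
    then have "b \<in> parents x" using bx parentsD[of x b] by auto
    moreover have "b \<in> parents a" using crossD[OF 1(1)] by simp
    ultimately show False using cross_common_parent[OF 1 ne] eq by simp
  next
    case 2
    have "lev a mod 3 = lev y mod 3" using cross_color_eqD[OF 2] eq sym by metis
    moreover have "lev a = Suc (lev b)" "lev y = Suc (lev x)" using crossD[OF 2(1)] crossD[OF 2(2)] by simp_all
    ultimately have "b = x" using lev_bx mod3 by metis
    then show False using cross_common_parent[OF 2, of b] crossD[OF 2(1)] crossD[OF 2(2)] eq ne sym by metis
  next
    case 3
    have "lev b mod 3 = lev x mod 3" using cross_color_eqD[OF 3] eq sym by metis
    then have "b = x" using lev_bx mod3 by metis
    then show False using cross_unique 3 ne sym by metis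
  next
    case 4
    have "lev b mod 3 = lev y mod 3" using cross_color_eqD[OF 4] eq sym by metis
    moreover have "lev y = Suc (lev x)" using crossD[OF 4(2)] by simp
    ultimately have "lev b = Suc (lev x)" using lev_bx mod3 by metis
    then have "x \<in> parents b" using bx parentsD[of b x] by auto
    then show False using cross_common_parent[OF 4, of x] crossD[OF 4(2)] eq ne sym by metis
  qed
qed

lemma up_parents: "up a b \<Longrightarrow> b \<in> parents a"
  using parent_in[of a] by (auto simp: up_def)

lemma color_proper:
  assumes "{a, b} \<in> E" "{b, d} \<in> E" "a \<noteq> d"
  shows "color {a, b} \<noteq> color {b, d}"
proof
  assume eq: "color {a, b} = color {b, d}"
  have ne: "{a, b} \<noteq> {b, d}" using assms(3) by (auto simp: doubleton_eq_iff)
  from assms(1,2) eq show False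
  proof (cases rule: same_color_type)
    case 1
    then show False using level_edges_joined[of a b b d] ne eq by blast
  next
    case 2
    then show False using good_proper[OF c 2 assms(3)] edge_color_eq eq by metis
  next
    case 3
    then show False using cross_edges_joined[of a b b d] ne eq by blast
  qed
qed

text \<open>The first and third edge have the same type, and so do the second and fourth. Layer
  edges are excluded first; then every edge runs between layers, and the middle edges are admissible
  joins for excluding edges to second parents. What remains lies in the forest.\<close>

lemma color_no_bichromatic:
  assumes E: "{u, v} \<in> E" "{v, w} \<in> E" "{w, x} \<in> E" "{x, y} \<in> E"
    and dist: "u \<noteq> w" "v \<noteq> x" "w \<noteq> y"
    and ne: "{u, v} \<noteq> {w, x}" "{v, w} \<noteq> {x, y}"
    and eq: "color {u, v} = color {w, x}" "color {v, w} = color {x, y}"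
  shows False
proof -
  have not_level: "\<not> ({u, v} \<in> level_edges \<and> {w, x} \<in> level_edges)" "\<not> ({v, w} \<in> level_edges \<and> {x, y} \<in> level_edges)"
    using level_edges_joined[of u v w x] level_edges_joined[of v w x y] E ne eq by blast+
  have joined: "a \<in> parents b \<or> b \<in> parents a" if "up a b \<or> up b a \<or> cross a b \<or> cross b a" for a b
    using that up_parents crossD by blast
  from E(1,3) eq(1) not_level(1) have 1: "(up u v \<or> up v u) \<and> (up w x \<or> up x w) \<or> (cross u v \<or> cross v u) \<and> (cross w x \<or> cross x w)"
    by (cases rule: same_color_type) auto
  from E(2,4) eq(2) not_level(2) have 2: "(up v w \<or> up w v) \<and> (up x y \<or> up y x) \<or> (cross v w \<or> cross w v) \<and> (cross x y \<or> cross y x)"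
    by (cases rule: same_color_type) auto
  have "\<not> ((cross u v \<or> cross v u) \<and> (cross w x \<or> cross x w))"
    using cross_edges_joined[of u v w x] joined[of v w] 2 ne(1) eq(1) by blast
  moreover have "\<not> ((cross v w \<or> cross w v) \<and> (cross x y \<or> cross y x))"
    using cross_edges_joined[of v w x y] joined[of w x] 1 ne(2) eq(2) by blast
  ultimately have t: "up u v \<or> up v u" "up v w \<or> up w v" "up w x \<or> up x w" "up x y \<or> up y x"
    using 1 2 by blast+
  show False
    using good_no_bichromatic[OF c t dist] eq t edge_color_eq by metis
qed

lemma color_less:
  assumes e: "e \<in> E"
  shows "color e < K + 12"
proof -
  obtain a b where ab: "e = {a, b}"
    using e simple by (auto simp: simple_graph_def card_2_iff)
  have "color {a, b} < K + 12"
    by (rule edge_types[of a b]) (use e ab color_ranges[of a b] in \<open>auto intro: less_le_trans\<close>)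
  then show ?thesis by (simp add: ab)
qed

lemma color_star: "star_edge_coloring E color"
proof -
  \<comment> \<open>\<open>y = u\<close> is permitted, so one statement yields the condition for
    paths and for four-cycles.\<close>
  have three: "card (color ` {{u, v}, {v, w}, {w, x}, {x, y}}) \<ge> 3"
    if E: "{{u, v}, {v, w}, {w, x}, {x, y}} \<subseteq> E" and d: "distinct [u, v, w, x]" "y \<notin> {v, w, x}" for u v w x y
  proof (rule ccontr)
    let ?e1 = "color {u, v}" and ?e2 = "color {v, w}" and ?e3 = "color {w, x}" and ?e4 = "color {x, y}"
    assume "\<not> ?thesis"
    then have two: "card {?e1, ?e2, ?e3, ?e4} \<le> 2" by simp
    have "?e1 \<noteq> ?e2" "?e2 \<noteq> ?e3" "?e3 \<noteq> ?e4"
      using color_proper[of u v w] color_proper[of v w x] color_proper[of w x y] E d by auto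
    \<comment> \<open>A proper coloring with only two colors must alternate.\<close>
    then have "?e1 = ?e3" "?e2 = ?e4"
      using two by (auto simp: card_insert_if split: if_splits)
    then show False
      using color_no_bichromatic[of u v w x y] E d by (auto simp: doubleton_eq_iff)
  qed
  have proper: "color e \<noteq> color e'" if e: "e \<in> E" "e' \<in> E" "e \<noteq> e'" "e \<inter> e' \<noteq> {}" for e e'
  proof -
    obtain b where b: "b \<in> e" "b \<in> e'" using e(4) by blast
    have "card e = 2" "card e' = 2"
      using simple e by (auto simp: simple_graph_def)
    then obtain a d where ad: "e = {a, b}" "e' = {b, d}"
      using b by (auto simp: card_2_iff)
    then have "a \<noteq> d" using e(3) by auto
    then show ?thesis using color_proper[of a b d] e ad by simp
  qed
  show ?thesis
    unfolding star_edge_coloring_def proper_edge_coloring_def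
    using proper three by (auto simp del: image_insert)
qed

end

lemma (in K23_free_graph) star_coloring_exists:
  assumes "\<And>v. v \<in> V \<Longrightarrow> degree E v \<le> D"
  shows "\<exists>f :: 'a set \<Rightarrow> nat. star_edge_coloring E f \<and> f ` E \<subseteq> {..<D + D div 2 + 12}"
proof -
  obtain c where c: "\<forall>q\<in>V. layered_forest.good_at V lev parent D c q"
    using layered_forest.good_coloring_exists[OF layered_forest_parent[OF assms]] by blast
  obtain g :: "'a set \<Rightarrow> nat" where g: "(\<forall>e\<in>level_edges. g e < 3) \<and>
    (\<forall>e\<in>level_edges. \<forall>e'\<in>level_edges. \<forall>d\<in>level_edges.
       e \<noteq> e' \<longrightarrow> d \<inter> e \<noteq> {} \<longrightarrow> d \<inter> e' \<noteq> {} \<longrightarrow> g e \<noteq> g e')"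
    using level_edges_coloring ..
  obtain h :: "'a \<Rightarrow> nat" where h: "(\<forall>v. h v < 2) \<and>
    (\<forall>v w. two_parents v \<longrightarrow> two_parents w \<longrightarrow> share_parent v w \<longrightarrow> h v \<noteq> h w)"
    using second_parent_coloring ..
  interpret colored_K23_free_graph V E D c g h
  proof
    show "degree E v \<le> D" if "v \<in> V" for v
      by (rule assms[OF that])
    show "layered_forest.good_at V lev parent D c q" if "q \<in> V" for q
      by (rule c[rule_format, OF that])
    show "g e < 3" if "e \<in> level_edges" for e
      by (rule g[THEN conjunct1, rule_format, OF that])
    show "g e \<noteq> g e'" if "e \<in> level_edges" "e' \<in> level_edges" "d \<in> level_edges" "e \<noteq> e'"
      "d \<inter> e \<noteq> {}" "d \<inter> e' \<noteq> {}" for e e' d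
      by (rule g[THEN conjunct2, rule_format, OF that])
    show "h v < 2" for v
      by (rule h[THEN conjunct1, rule_format])
    show "h v \<noteq> h w" if "two_parents v" "two_parents w" "share_parent v w" for v w
      by (rule h[THEN conjunct2, rule_format, OF that])
  qed
  show ?thesis
    using color_star color_less by blast
qed

theorem theorem6:
  fixes V :: "'a set" and E :: "'a set set" and \<Delta> :: nat
  assumes "simple_graph V E"
    and "outerplanar V E"
    and "max_degree V E = \<Delta>"
  shows "int (star_chromatic_index E) \<le> \<lfloor>3 / 2 * real \<Delta>\<rfloor> + 12"
proof -
  interpret K23_free_graph V E
    using assms outerplanar_K23_free by unfold_locales
  have "degree E v \<le> \<Delta>" if "v \<in> V" for v
  proof -
    have "degree E v \<le> Max (insert 0 (degree E ` V))"
      using that finite_V by (intro Max_ge) auto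
    then show ?thesis using assms(3) by (simp add: max_degree_def)
  qed
  then have "\<exists>f :: 'a set \<Rightarrow> nat. star_edge_coloring E f \<and> f ` E \<subseteq> {..<\<Delta> + \<Delta> div 2 + 12}"
    by (rule star_coloring_exists)
  then have "star_chromatic_index E \<le> \<Delta> + \<Delta> div 2 + 12"
    unfolding star_chromatic_index_def by (rule Least_le)
  moreover have "\<lfloor>3 / 2 * real \<Delta>\<rfloor> = int (\<Delta> + \<Delta> div 2)"
  proof -
    have "3 / 2 * real \<Delta> = real_of_int (3 * int \<Delta>) / real_of_int 2" by simp
    also have "\<lfloor>\<dots>\<rfloor> = 3 * int \<Delta> div 2" by (rule floor_divide_of_int_eq)
    finally show ?thesis by simp
  qed
  ultimately show ?thesis by simp
qed

end
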